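(* Let $P$ be a probability distribution on $\mathcal{X}$, and let $R>0$, $K>0$. Suppose the codebook is random, with all $n\lfloor e^{nR}\rfloor$ letters drawn i.i.d. according to $P$, and let $\overline{P}_e^{(n)}$ be the error probability of the maximum-likelihood decoder averaged over the equiprobable messages, the random codebooks and the random channel instances. Then the limit below exists and \[ \lim_{n\to\infty} -\tfrac{1}{n}\log \overline{P}_e^{(n)} \;=\; E_e(P,R,K), \] where \[ E_e(P,R,K)=\min_{TV}\Big\{ D(TV\,\|\,PW) + \big|A^{P}_{TV}-R+\big|B^{W}_{TV}-K\big|^{+}\big|^{+}\Big\}. \]
   Context: Channel model: $\mathcal{X},\mathcal{Y}$ are finite alphabets and $W(y|x)$ is a fixed conditional distribution (the channel-generating distribution). For a block length $n$, a rate $R>0$ and $K>0$, a codebook $\mathcal{C}_n$ consists of $\lfloor e^{nR}\rfloor$ codewords $\mathbf{x}_m\in\mathcal{X}^n$, $m=1,\dots,\lfloor e^{nR}\rfloor$. A channel instance is generated as follows: independently for each message $m$, a "cloud" of $\lfloor e^{nK}\rfloor$ sequences $\mathbf{y}\in\mathcal{Y}^n$ is generated, each sequence independently of the others, with letters $y_i$ drawn independently according to $W(\cdot|x_{m,i})$. Messages are equiprobable; when message $m$ is sent, the channel output is one of the $\lfloor e^{nK}\rfloor$ (not necessarily distinct) vectors of the cloud of $m$, chosen uniformly at random. The decoder knows the codebook and the channel instance (all clouds); the maximum-likelihood decoder outputs a message whose cloud contains the largest number of copies of the received vector (ties broken at random). All logarithms are natural. Notation: $TV$ denotes a joint distribution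 on $\mathcal{Y}\times\mathcal{X}$ with marginal $T$ on $\mathcal{Y}$ and conditional $V(x|y)$; $PW$ denotes the joint distribution $P(x)W(y|x)$; $D(TV\|PW)=\sum_{x,y}T(y)V(x|y)\log\frac{T(y)V(x|y)}{P(x)W(y|x)}$; $A^{P}_{TV}=D(V\|P|T)=\sum_{x,y}T(y)V(x|y)\log\frac{V(x|y)}{P(x)}$; $B^{W}_{TV}=\mathbb{E}_{TV}[-\log W(Y|X)]$; $|t|^{+}=\max\{0,t\}$. The minimum is over all joint distributions $TV$. *)

theory Defs
  imports Complex_Main "HOL-Library.FuncSet"
begin

definition num_msgs :: "real \<Rightarrow> nat \<Rightarrow> nat" where
  "num_msgs R n = nat \<lfloor>exp (real n * R)\<rfloor>"

text \<open>A channel instance Y maps (message m, cloud index l, position i) to an output letter.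
  The output vector number l of the cloud of message m:\<close>
definition cloud_vec :: "(nat \<times> nat \<times> nat \<Rightarrow> 'y) \<Rightarrow> nat \<Rightarrow> nat \<Rightarrow> nat \<Rightarrow> 'y list" where
  "cloud_vec Y n m l = map (\<lambda>i. Y (m, l, i)) [0..<n]"

definition cloud_count :: "(nat \<times> nat \<times> nat \<Rightarrow> 'y) \<Rightarrow> nat \<Rightarrow> nat \<Rightarrow> nat \<Rightarrow> 'y list \<Rightarrow> nat" where
  "cloud_count Y n L m' v = card {l \<in> {..<L}. cloud_vec Y n m' l = v}"

text \<open>Probability (over random tie-breaking) that the ML decoder errs, given the channel
  instance Y, the sent message m and that the output is the j-th vector of its cloud.\<close>
definition ml_error :: "(nat \<times> nat \<times> nat \<Rightarrow> 'y) \<Rightarrow> nat \<Rightarrow> nat \<Rightarrow> nat \<Rightarrow> nat \<Rightarrow> nat \<Rightarrow> real" where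
  "ml_error Y n M L m j =
     (let v = cloud_vec Y n m j;
          c = (\<lambda>m'. cloud_count Y n L m' v);
          best = {m' \<in> {..<M}. \<forall>m'' \<in> {..<M}. c m'' \<le> c m'}
      in 1 - (if m \<in> best then 1 / real (card best) else 0))"

text \<open>Average error probability of the ML decoder over equiprobable messages, i.i.d.-P random
  codebooks (codebook C maps (message, position) to an input letter), random channel
  instances, and the uniformly chosen vector of the cloud.\<close>
definition avg_error_prob ::
  "('x::finite \<Rightarrow> real) \<Rightarrow> ('x \<Rightarrow> 'y::finite \<Rightarrow> real) \<Rightarrow> real \<Rightarrow> real \<Rightarrow> nat \<Rightarrow> real" where
  "avg_error_prob P W R K n =
     (let M = num_msgs R n; L = num_msgs K n in
      \<Sum>C \<in> PiE ({..<M} \<times> {..<n}) (\<lambda>_. UNIV).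
        (\<Prod>p \<in> {..<M} \<times> {..<n}. P (C p)) *
        (\<Sum>Y \<in> PiE ({..<M} \<times> {..<L} \<times> {..<n}) (\<lambda>_. UNIV).
           (\<Prod>p \<in> {..<M} \<times> {..<L} \<times> {..<n}. W (C (fst p, snd (snd p))) (Y p)) *
           ((1 / real M) * (\<Sum>m<M. (1 / real L) * (\<Sum>j<L. ml_error Y n M L m j)))))"

text \<open>Joint distributions TV on Y \<times> X, represented by their joint pmf Q(y,x) = T(y)V(x|y).\<close>
definition joint_dist :: "('y::finite \<times> 'x::finite \<Rightarrow> real) \<Rightarrow> bool" where
  "joint_dist Q \<longleftrightarrow> (\<forall>z. Q z \<ge> 0) \<and> (\<Sum>z\<in>UNIV. Q z) = 1"

definition marg_T :: "('y \<times> 'x::finite \<Rightarrow> real) \<Rightarrow> 'y \<Rightarrow> real" where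
  "marg_T Q y = (\<Sum>x\<in>UNIV. Q (y, x))"

definition cond_V :: "('y \<times> 'x::finite \<Rightarrow> real) \<Rightarrow> 'y \<Rightarrow> 'x \<Rightarrow> real" where
  "cond_V Q y x = Q (y, x) / marg_T Q y"

text \<open>D(TV || PW), with 0 log 0 = 0 (finite when supp TV \<subseteq> supp PW).\<close>
definition div_D :: "('x::finite \<Rightarrow> real) \<Rightarrow> ('x \<Rightarrow> 'y::finite \<Rightarrow> real) \<Rightarrow> ('y \<times> 'x \<Rightarrow> real) \<Rightarrow> real" where
  "div_D P W Q = (\<Sum>(y,x)\<in>UNIV. if Q (y,x) > 0
      then marg_T Q y * cond_V Q y x * ln (marg_T Q y * cond_V Q y x / (P x * W x y)) else 0)"

definition A_TV :: "('x::finite \<Rightarrow> real) \<Rightarrow> ('y::finite \<times> 'x \<Rightarrow> real) \<Rightarrow> real" where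
  "A_TV P Q = (\<Sum>(y,x)\<in>UNIV. if Q (y,x) > 0
      then marg_T Q y * cond_V Q y x * ln (cond_V Q y x / P x) else 0)"

definition B_TV :: "('x::finite \<Rightarrow> 'y::finite \<Rightarrow> real) \<Rightarrow> ('y \<times> 'x \<Rightarrow> real) \<Rightarrow> real" where
  "B_TV W Q = (\<Sum>(y,x)\<in>UNIV. if Q (y,x) > 0
      then marg_T Q y * cond_V Q y x * (- ln (W x y)) else 0)"

definition pos_part :: "real \<Rightarrow> real" where
  "pos_part t = max 0 t"

text \<open>E_e(P,R,K): minimum over joint distributions TV. Distributions with D(TV||PW) = \<infinity>
  (support not contained in that of PW) never attain the minimum, so the minimum is taken
  over those with supp TV \<subseteq> supp PW, on which all quantities are finite.\<close>
definition E_e :: "('x::finite \<Rightarrow> real) \<Rightarrow> ('x \<Rightarrow> 'y::finite \<Rightarrow> real) \<Rightarrow> real \<Rightarrow> real \<Rightarrow> real" where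
  "E_e P W R K = Inf {div_D P W Q + pos_part (A_TV P Q - R + pos_part (B_TV W Q - K)) | Q.
       joint_dist Q \<and> (\<forall>y x. Q (y, x) > 0 \<longrightarrow> P x * W x y > 0)}"

end

theory Submission
  imports Defs "HOL-Analysis.Weierstrass_Theorems" "HOL-Analysis.Complex_Transcendental"
begin

text \<open>Up to a factor 2, the sent message is decoded wrongly iff some other message has at least as many
  copies of the received vector \<open>y\<close> in its cloud. Summing over the cloud, the error probability is
  therefore comparable to \<open>(1/L) \<Sum>\<^sub>y E[N; N \<le> max N']\<close>, where \<open>N\<close> is the number of copies of \<open>y\<close> in
  the cloud of one random codeword and \<open>N'\<close> runs over the \<open>M - 1\<close> other, i.i.d., copies of \<open>N\<close>.
  Given the joint type of codeword and \<open>y\<close>, \<open>N\<close> is binomial with parameter \<open>p\<close>, so \<open>N\<close> is a mixture of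
  binomials with polynomially many components \<open>(a, p)\<close>. The elementary bounds
  \<open>E[N; 1 \<le> N \<le> N'] \<le> min (Lp) (Lp') (Lp Lp')\<close> and \<open>E[N; N \<le> N'] \<ge> Lp min(1, Lp) / 8\<close>
  for independent binomials show that each component mainly competes with itself: the expectation is,
  up to polynomial factors, the maximum of \<open>L a p min(1, M a min(1, L p))\<close>. Summation over \<open>y\<close> turns
  this into \<open>exp(-n (D + |A - R + |B - K|\<^sup>+|\<^sup>+))\<close> for the type. In the converse direction an arbitrary \<open>Q\<close> is
  reached by Chebyshev's inequality under \<open>Q\<^sup>n\<close>, which together with the pigeonhole principle gives a
  type class of \<open>Q\<^sup>n\<close>-probability at least \<open>1/poly(n)\<close> whose exponents are close to those of \<open>Q\<close>.\<close>

section \<open>Binomial competition\<close>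

text \<open>Bernoulli's inequality. In probabilistic terms it is the union bound for
  \<open>N\<close> independent events of probability \<open>q\<close>.\<close>

lemma one_minus_power_le:
  fixes q :: real
  assumes "0 \<le> q" "q \<le> 1"
  shows "1 - (1 - q) ^ N \<le> min 1 (real N * q)"
proof -
  have "1 + real N * (- q) \<le> (1 + (- q)) ^ N"
    using assms by (intro Bernoulli_inequality) auto
  moreover have "0 \<le> (1 - q) ^ N"
    using assms by simp
  ultimately show ?thesis by simp
qed

text \<open>Independence makes the union bound tight up to a factor 2: with t = N q, (1 - q)^N <=
  exp(-t) <= 1/(1+t), and t/(1+t) >= min(1,t)/2.\<close>

lemma one_minus_power_ge:
  fixes q :: real
  assumes "0 \<le> q" "q \<le> 1"
  shows "min 1 (real N * q) / 2 \<le> 1 - (1 - q) ^ N"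
proof -
  define t where "t = real N * q"
  have t: "0 \<le> t" using assms by (simp add: t_def)
  have "(1 - q) ^ N \<le> exp (- q) ^ N"
    using assms exp_ge_add_one_self[of "- q"] by (intro power_mono) auto
  also have "\<dots> = 1 / exp t"
    by (simp add: t_def exp_of_nat_mult exp_minus inverse_eq_divide power_one_over)
  also have "\<dots> \<le> 1 / (1 + t)"
    using t exp_ge_add_one_self[of t] by (intro divide_left_mono) auto
  finally have "(1 - q) ^ N \<le> 1 / (1 + t)" .
  moreover have "1 - 1 / (1 + t) \<ge> min 1 t / 2"
  proof (cases "t \<le> 1")
    case True
    have "t * (1 + t) \<le> t * 2" using t True by (intro mult_left_mono) auto
    then show ?thesis using True t by (simp add: field_simps)
  next
    case False
    then show ?thesis by (simp add: field_simps)
  qed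
  ultimately show ?thesis by (simp add: t_def)
qed

text \<open>\<open>Bernstein n k p\<close> is the mass of Bin(n,p) at k; the recursion conditions on
  the outcome of one of the n+1 trials.\<close>

lemma Bernstein_Suc_Suc:
  "Bernstein (Suc n) (Suc k) p = p * Bernstein n k p + (1 - p) * Bernstein n (Suc k) p"
proof (cases "Suc k \<le> n")
  case True
  then have "n - k = Suc (n - Suc k)" by simp
  then show ?thesis by (simp add: Bernstein_def algebra_simps)
next
  case False
  then show ?thesis by (cases "k = n") (auto simp: Bernstein_def binomial_eq_0 algebra_simps)
qed

lemma sum_Bernstein_Suc:
  "(\<Sum>k\<le>Suc n. Bernstein (Suc n) k p * f k) =
     p * (\<Sum>k\<le>n. Bernstein n k p * f (Suc k)) + (1 - p) * (\<Sum>k\<le>n. Bernstein n k p * f k)"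
proof -
  have z: "Bernstein n (Suc n) p = 0" by (simp add: Bernstein_def)
  have "(\<Sum>k\<le>Suc n. Bernstein (Suc n) k p * f k) =
      (1 - p) * (Bernstein n 0 p * f 0) + (\<Sum>k\<le>n. Bernstein (Suc n) (Suc k) p * f (Suc k))"
    by (simp only: sum.atMost_Suc_shift) (simp add: Bernstein_def)
  also have "(\<Sum>k\<le>n. Bernstein (Suc n) (Suc k) p * f (Suc k)) =
      p * (\<Sum>k\<le>n. Bernstein n k p * f (Suc k)) + (1 - p) * (\<Sum>k\<le>n. Bernstein n (Suc k) p * f (Suc k))"
    by (simp add: Bernstein_Suc_Suc sum_distrib_left sum.distrib algebra_simps flip: sum.distrib)
  also have "(1 - p) * (Bernstein n 0 p * f 0) + \<dots> =
      p * (\<Sum>k\<le>n. Bernstein n k p * f (Suc k)) + (1 - p) * (\<Sum>k\<le>Suc n. Bernstein n k p * f k)"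
    by (simp only: sum.atMost_Suc_shift[of _ n]) (simp add: algebra_simps)
  also have "(\<Sum>k\<le>Suc n. Bernstein n k p * f k) = (\<Sum>k\<le>n. Bernstein n k p * f k)"
    by (simp add: z)
  finally show ?thesis .
qed

lemma sum_PiE_insert:
  assumes "a \<notin> A"
  shows "(\<Sum>h\<in>PiE (insert a A) B. F h) = (\<Sum>y\<in>B a. \<Sum>g\<in>PiE A B. F (g(a := y)))"
  unfolding PiE_insert_eq sum.reindex[OF inj_combinator[OF assms]] sum.cartesian_product
  by (simp add: case_prod_unfold)

text \<open>The number of hits of \<open>v\<close> among independent letters of law \<open>w\<close>
  is binomial. In the induction the new letter either hits \<open>v\<close>, with weight
  \<open>w v\<close>, or misses it, with total weight \<open>1 - w v\<close>; this is the recursion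
  of \<open>sum_Bernstein_Suc\<close>.\<close>

lemma sum_PiE_count:
  fixes w :: "'v \<Rightarrow> real" and f :: "nat \<Rightarrow> real"
  assumes "finite A" "finite \<Omega>" "v \<in> \<Omega>" "sum w \<Omega> = 1"
  shows "(\<Sum>h\<in>PiE A (\<lambda>_. \<Omega>). (\<Prod>l\<in>A. w (h l)) * f (card {l\<in>A. h l = v})) =
     (\<Sum>k\<le>card A. Bernstein (card A) k (w v) * f k)"
  using assms(1)
proof (induction A arbitrary: f rule: finite_induct)
  case empty
  then show ?case by (simp add: Bernstein_def)
next
  case (insert a A)
  let ?S = "\<lambda>f. \<Sum>h\<in>PiE A (\<lambda>_. \<Omega>). (\<Prod>l\<in>A. w (h l)) * f (card {l\<in>A. h l = v})"
  have upd: "(\<Prod>l\<in>insert a A. w ((g(a := y)) l)) * f (card {l\<in>insert a A. (g(a := y)) l = v}) =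
      w y * ((\<Prod>l\<in>A. w (g l)) * (if y = v then f (Suc (card {l\<in>A. g l = v})) else f (card {l\<in>A. g l = v})))"
    for g y
  proof -
    have "(\<Prod>l\<in>A. w ((g(a := y)) l)) = (\<Prod>l\<in>A. w (g l))"
      using insert by (intro prod.cong) auto
    moreover have "{l\<in>insert a A. (g(a := y)) l = v} =
        (if y = v then insert a {l\<in>A. g l = v} else {l\<in>A. g l = v})"
      using insert by auto
    ultimately show ?thesis using insert by auto
  qed
  have "(\<Sum>h\<in>PiE (insert a A) (\<lambda>_. \<Omega>). (\<Prod>l\<in>insert a A. w (h l)) * f (card {l\<in>insert a A. h l = v})) =
      (\<Sum>y\<in>\<Omega>. w y * (if y = v then ?S (\<lambda>k. f (Suc k)) else ?S f))"
    unfolding sum_PiE_insert[OF insert(2)] upd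
    by (intro sum.cong refl) (auto simp: sum_distrib_left)
  also have "\<dots> = w v * ?S (\<lambda>k. f (Suc k)) + (\<Sum>y\<in>\<Omega> - {v}. w y * ?S f)"
    using assms by (subst sum.remove[of _ v]) (auto intro!: sum.cong)
  also have "(\<Sum>y\<in>\<Omega> - {v}. w y * ?S f) = (1 - w v) * ?S f"
    using assms by (simp add: sum_diff1 flip: sum_distrib_right)
  finally show ?case
    unfolding insert.IH[of f] insert.IH[of "\<lambda>k. f (Suc k)"]
    by (simp only: sum_Bernstein_Suc card_insert_disjoint[OF insert.hyps])
qed

lemma Bernstein_double_sum:
  "(\<Sum>k\<le>L. \<Sum>j\<le>L. (Bernstein L k p * Bernstein L j p') * (f k * g j)) =
   (\<Sum>k\<le>L. f k * Bernstein L k p) * (\<Sum>j\<le>L. g j * Bernstein L j p')"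
  by (simp add: sum_product mult_ac)

text \<open>\<open>E[N; N \<le> N']\<close> for independent \<open>N ~ Bin(L, p)\<close> and \<open>N' ~ Bin(L, p')\<close>.\<close>

definition overtake :: "nat \<Rightarrow> real \<Rightarrow> real \<Rightarrow> real" where
  "overtake L p p' =
     (\<Sum>k\<le>L. \<Sum>j\<le>L. (Bernstein L k p * Bernstein L j p') * (if k \<le> j then real k else 0))"

text \<open>Each bound dominates the integrand by a product f(k) g(j), namely k, j or k j, so that
  the double sum factors into binomial means. The product k j works because k <= j with k > 0 forces
  j >= 1.\<close>

lemma overtake_le:
  assumes "0 \<le> p" "p \<le> 1" "0 \<le> p'" "p' \<le> 1"
  shows "overtake L p p' \<le> real L * p" "overtake L p p' \<le> real L * p'"
    "overtake L p p' \<le> (real L * p) * (real L * p')"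
proof -
  have B: "0 \<le> Bernstein L k p * Bernstein L j p'" for k j
    using assms by (simp add: Bernstein_nonneg)
  have *: "overtake L p p' \<le> (\<Sum>k\<le>L. \<Sum>j\<le>L. (Bernstein L k p * Bernstein L j p') * (f k * g j))"
    if "\<And>k j. (if k \<le> j then real k else 0) \<le> f k * g j" for f g
    unfolding overtake_def by (intro sum_mono mult_left_mono B that)
  show "overtake L p p' \<le> real L * p"
    using *[of "\<lambda>k. real k" "\<lambda>_. 1"] unfolding Bernstein_double_sum by simp
  show "overtake L p p' \<le> real L * p'"
    using *[of "\<lambda>_. 1" "\<lambda>j. real j"] unfolding Bernstein_double_sum by simp
  have "real k \<le> real k * real j" if "k \<le> j" for k j :: nat
    using that mult_left_mono[of 1 "real j" "real k"] by (cases "j = 0") auto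
  then show "overtake L p p' \<le> (real L * p) * (real L * p')"
    using *[of "\<lambda>k. real k" "\<lambda>j. real j"] unfolding Bernstein_double_sum by simp
qed

text \<open>The two counts are exchangeable, so twice the expectation is E[N; N <= N'] +
  E[N'; N' <= N], and these two integrands together are at least min(N,N').\<close>

lemma overtake_ge_min:
  assumes "0 \<le> p" "p \<le> 1"
  shows "(\<Sum>k\<le>L. \<Sum>j\<le>L. (Bernstein L k p * Bernstein L j p) * min (real k) (real j)) \<le> 2 * overtake L p p"
proof -
  have B: "0 \<le> Bernstein L k p * Bernstein L j p" for k j
    using assms by (simp add: Bernstein_nonneg)
  have "overtake L p p =
     (\<Sum>k\<le>L. \<Sum>j\<le>L. (Bernstein L k p * Bernstein L j p) * (if j \<le> k then real j else 0))"
    unfolding overtake_def by (subst sum.swap) (simp add: mult_ac)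
  then have "2 * overtake L p p = (\<Sum>k\<le>L. \<Sum>j\<le>L. (Bernstein L k p * Bernstein L j p) *
      ((if k \<le> j then real k else 0) + (if j \<le> k then real j else 0)))"
    unfolding distrib_left sum.distrib by (simp add: overtake_def)
  also have "\<dots> \<ge> (\<Sum>k\<le>L. \<Sum>j\<le>L. (Bernstein L k p * Bernstein L j p) * min (real k) (real j))"
    by (intro sum_mono mult_left_mono B) auto
  finally show ?thesis .
qed

text \<open>It suffices that E[min(N,N')] >= mu min(1,mu)/4 for the mean mu = L p. For mu <= 1 the
  minimum is at least the indicator that both counts are positive; for mu > 1 a second moment
  argument applies.\<close>

lemma overtake_self_ge:
  assumes "0 \<le> p" "p \<le> 1"
  shows "real L * p * min 1 (real L * p) / 8 \<le> overtake L p p"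
proof -
  define \<mu> where "\<mu> = real L * p"
  have \<mu>: "0 \<le> \<mu>" using assms by (simp add: \<mu>_def)
  have B: "0 \<le> Bernstein L k p * Bernstein L j p" for k j
    using assms by (simp add: Bernstein_nonneg)
  let ?E = "\<lambda>F. \<Sum>k\<le>L. \<Sum>j\<le>L. (Bernstein L k p * Bernstein L j p) * F k j"
  have mono: "?E F \<le> ?E (\<lambda>k j. min (real k) (real j))" if "\<And>k j. F k j \<le> min (real k) (real j)" for F
    by (intro sum_mono mult_left_mono B that)
  have "\<mu> * min 1 \<mu> / 4 \<le> ?E (\<lambda>k j. min (real k) (real j))"
  proof (cases "\<mu> \<le> 1")
    case True
    have P1: "(\<Sum>k\<le>L. (if 1 \<le> k then 1 else 0) * Bernstein L k p) = 1 - (1 - p) ^ L"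
    proof -
      have "(\<Sum>k\<le>L. (if 1 \<le> k then 1 else 0) * Bernstein L k p) =
          (\<Sum>k\<le>L. Bernstein L k p - (if k = 0 then Bernstein L k p else 0))"
        by (intro sum.cong) auto
      also have "\<dots> = 1 - Bernstein L 0 p"
        by (simp only: sum_subtractf sum_Bernstein) simp
      finally show ?thesis by (simp add: Bernstein_def)
    qed
    have "\<mu> / 2 \<le> 1 - (1 - p) ^ L"
      using one_minus_power_ge[of p L] assms True by (simp add: \<mu>_def)
    then have "(\<mu> / 2) * (\<mu> / 2) \<le> (1 - (1 - p) ^ L) * (1 - (1 - p) ^ L)"
      using \<mu> by (intro mult_mono) auto
    also have "\<dots> = ?E (\<lambda>k j. (if 1 \<le> k then 1 else 0) * (if 1 \<le> j then 1 else 0))"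
      unfolding Bernstein_double_sum P1 by simp
    also have "\<dots> \<le> ?E (\<lambda>k j. min (real k) (real j))"
      by (intro mono) auto
    finally show ?thesis using True by simp
  next
    case False
    then have \<mu>1: "1 < \<mu>" by simp
    have m2: "(\<Sum>k\<le>L. (real k)\<^sup>2 * Bernstein L k p) = \<mu>\<^sup>2 + \<mu> - \<mu> * p"
    proof -
      have "(\<Sum>k\<le>L. (real k)\<^sup>2 * Bernstein L k p) =
          (\<Sum>k\<le>L. real k * (real k - 1) * Bernstein L k p) + (\<Sum>k\<le>L. real k * Bernstein L k p)"
        unfolding sum.distrib[symmetric] by (simp add: power2_eq_square algebra_simps)
      also have "\<dots> = real L * (real L - 1) * p\<^sup>2 + real L * p"
        by simp
      finally show ?thesis by (simp add: \<mu>_def power2_eq_square algebra_simps)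
    qed
    have Lp: "real L * p = \<mu>" "p * real L = \<mu>" by (simp_all add: \<mu>_def)
    have m1: "(\<Sum>k\<le>L. real k * Bernstein L k p) = \<mu>" by (simp add: \<mu>_def)
    \<comment> \<open>A quadratic minorant of the minimum: min = (k+j)/2 - |k-j|/2, and |k-j|/2 <=
      (k-j)^2/(4 mu) + mu/4 by AM-GM. Its expectation involves only the first two moments.\<close>
    have "?E (\<lambda>k j. (real k + real j) / 2 - (real k - real j)\<^sup>2 / (4 * \<mu>) - \<mu> / 4) =
        ?E (\<lambda>k j. real k * (1 / 2)) + ?E (\<lambda>k j. 1 * (real j / 2)) - ?E (\<lambda>k j. (real k)\<^sup>2 * (1 / (4 * \<mu>)))
        - ?E (\<lambda>k j. 1 * ((real j)\<^sup>2 / (4 * \<mu>))) + ?E (\<lambda>k j. real k * (real j / (2 * \<mu>)))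
        - ?E (\<lambda>k j. 1 * (\<mu> / 4))"
      unfolding sum.distrib[symmetric] sum_subtractf[symmetric]
      using \<mu>1 by (intro sum.cong refl) (simp add: field_simps power2_eq_square)
    also have "\<dots> = \<mu> / 2 + \<mu> / 2 - 2 * ((\<mu>\<^sup>2 + \<mu> - \<mu> * p) / (4 * \<mu>)) + \<mu> * (\<mu> / (2 * \<mu>)) - \<mu> / 4"
      unfolding Bernstein_double_sum using \<mu>1
      by (simp add: m1 m2 del: sum_k_Bernstein flip: sum_distrib_left sum_distrib_right sum_divide_distrib)
        (simp add: Lp field_simps power2_eq_square)
    also have "\<dots> = 3 * \<mu> / 4 - (1 - p) / 2"
      using \<mu>1 by (simp add: field_simps power2_eq_square)
    finally have E: "?E (\<lambda>k j. (real k + real j) / 2 - (real k - real j)\<^sup>2 / (4 * \<mu>) - \<mu> / 4)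
        = 3 * \<mu> / 4 - (1 - p) / 2" .
    have "(real k + real j) / 2 - (real k - real j)\<^sup>2 / (4 * \<mu>) - \<mu> / 4 \<le> min (real k) (real j)" for k j
    proof -
      have "0 \<le> (\<bar>real k - real j\<bar> - \<mu>)\<^sup>2" by simp
      then have "2 * \<bar>real k - real j\<bar> * \<mu> \<le> (real k - real j)\<^sup>2 + \<mu>\<^sup>2"
        by (simp add: power2_diff)
      then have "\<bar>real k - real j\<bar> / 2 \<le> (real k - real j)\<^sup>2 / (4 * \<mu>) + \<mu> / 4"
        using \<mu>1 by (simp add: field_simps power2_eq_square)
      moreover have "min (real k) (real j) = (real k + real j) / 2 - \<bar>real k - real j\<bar> / 2"
        by (simp add: min_def abs_if field_simps)
      ultimately show ?thesis by linarith
    qed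
    then have "3 * \<mu> / 4 - (1 - p) / 2 \<le> ?E (\<lambda>k j. min (real k) (real j))"
      unfolding E[symmetric] by (rule mono)
    \<comment> \<open>Here mu > 1 is used: (1-p)/2 <= 1/2 <= mu/2.\<close>
    moreover have "\<mu> * min 1 \<mu> / 4 \<le> 3 * \<mu> / 4 - (1 - p) / 2"
      using \<mu>1 assms by simp
    ultimately show ?thesis by linarith
  qed
  then show ?thesis
    using overtake_ge_min[OF assms, of L] by (simp add: \<mu>_def)
qed

section \<open>Mixtures of binomials\<close>

text \<open>\<open>E[N; N \<le> max N']\<close> when \<open>N\<close> and the \<open>M - 1\<close> competitors \<open>N'\<close> are i.i.d. with mass function \<open>\<beta>\<close> on \<open>{..L}\<close>.\<close>

definition race :: "nat \<Rightarrow> nat \<Rightarrow> (nat \<Rightarrow> real) \<Rightarrow> real" where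
  "race L M \<beta> = (\<Sum>k\<le>L. \<beta> k * (real k * (1 - (1 - (\<Sum>j\<in>{k..L}. \<beta> j)) ^ (M - 1))))"

lemma min_one_sum_le:
  fixes f :: "'a \<Rightarrow> real"
  assumes "finite A" "\<And>x. x \<in> A \<Longrightarrow> 0 \<le> f x"
  shows "min 1 (sum f A) \<le> (\<Sum>x\<in>A. min 1 (f x))"
  using assms
proof (induction A rule: finite_induct)
  case (insert x A)
  have "0 \<le> f x" "0 \<le> sum f A" using insert by (auto intro: sum_nonneg)
  then have "min 1 (f x + sum f A) \<le> min 1 (f x) + min 1 (sum f A)" by (auto simp: min_def)
  with insert show ?case by fastforce
qed simp

lemma overtake_eq:
  "overtake L p p' = (\<Sum>k\<le>L. Bernstein L k p * (real k * (\<Sum>j\<in>{k..L}. Bernstein L j p')))"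
  unfolding overtake_def
proof (intro sum.cong refl)
  fix k
  have "(\<Sum>j\<le>L. Bernstein L k p * Bernstein L j p' * (if k \<le> j then real k else 0)) =
      (\<Sum>j\<le>L. if k \<le> j then Bernstein L k p * Bernstein L j p' * real k else 0)"
    by (intro sum.cong) auto
  also have "\<dots> = (\<Sum>j\<in>{j\<in>{..L}. k \<le> j}. Bernstein L k p * Bernstein L j p' * real k)"
    by (simp add: sum.If_cases Int_def)
  also have "{j\<in>{..L}. k \<le> j} = {k..L}" by auto
  finally show "(\<Sum>j\<le>L. Bernstein L k p * Bernstein L j p' * (if k \<le> j then real k else 0)) =
      Bernstein L k p * (real k * (\<Sum>j\<in>{k..L}. Bernstein L j p'))"
    by (simp add: sum_distrib_left sum_distrib_right mult_ac)
qed

text \<open>In the application the components are the joint types of a random codeword with a fixed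
  output word: \<open>a\<close> is the probability of the type and \<open>p\<close> the value of the
  channel's product law on it.\<close>

locale binomial_mixture =
  fixes \<Theta> :: "'t set" and a p :: "'t \<Rightarrow> real" and L M :: nat
  assumes finite_\<Theta>: "finite \<Theta>"
    and a_nonneg: "\<And>t. t \<in> \<Theta> \<Longrightarrow> 0 \<le> a t" and a_sum: "sum a \<Theta> = 1"
    and p_nonneg: "\<And>t. t \<in> \<Theta> \<Longrightarrow> 0 \<le> p t" and p_le: "\<And>t. t \<in> \<Theta> \<Longrightarrow> p t \<le> 1"
begin

definition mass :: "nat \<Rightarrow> real" where
  "mass k = (\<Sum>t\<in>\<Theta>. a t * Bernstein L k (p t))"

definition tail :: "'t \<Rightarrow> nat \<Rightarrow> real" where
  "tail t k = (\<Sum>j\<in>{k..L}. Bernstein L j (p t))"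

lemma Bern_nonneg: "t \<in> \<Theta> \<Longrightarrow> 0 \<le> Bernstein L k (p t)"
  by (simp add: Bernstein_nonneg p_nonneg p_le)

lemma mass_nonneg: "0 \<le> mass k"
  unfolding mass_def by (intro sum_nonneg mult_nonneg_nonneg a_nonneg Bern_nonneg)

lemma tail_nonneg: "t \<in> \<Theta> \<Longrightarrow> 0 \<le> tail t k"
  unfolding tail_def by (intro sum_nonneg Bern_nonneg)

lemma tail_le_one: "t \<in> \<Theta> \<Longrightarrow> tail t k \<le> 1"
  unfolding tail_def sum_Bernstein[of L "p t", symmetric]
  by (intro sum_mono2) (auto intro: Bern_nonneg)

lemma mass_tail: "(\<Sum>j\<in>{k..L}. mass j) = (\<Sum>t\<in>\<Theta>. a t * tail t k)"
  unfolding mass_def tail_def sum_distrib_left by (rule sum.swap)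

lemma mass_tail_nonneg: "0 \<le> (\<Sum>j\<in>{k..L}. mass j)"
  by (intro sum_nonneg mass_nonneg)

lemma mass_tail_le_one: "(\<Sum>j\<in>{k..L}. mass j) \<le> 1"
  unfolding mass_tail a_sum[symmetric]
  by (intro sum_mono mult_left_le tail_le_one a_nonneg)

lemma overtake_tail: "overtake L (p t) (p t') = (\<Sum>k\<le>L. Bernstein L k (p t) * (real k * tail t' k))"
  by (simp add: overtake_eq tail_def)

text \<open>The competition between \<open>t\<close> and \<open>t'\<close> is charged to the
  component s with the larger product a p. The linear bound on \<open>overtake\<close> in the other
  component's p gives the estimate with \<open>a s\<close>, the bilinear bound the one with
  \<open>L * a s * p s\<close>; together they produce the inner minimum of
  \<open>G s\<close>.\<close>

lemma component_pair_le:
  assumes t: "t \<in> \<Theta>" "t' \<in> \<Theta>"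
  defines "G \<equiv> \<lambda>t. real L * (a t * p t) * min 1 (real M * a t * min 1 (real L * p t))"
  shows "a t * min (real L * p t) (real M * a t' * overtake L (p t) (p t')) \<le> G t + G t'"
proof -
  have nn: "0 \<le> a t" "0 \<le> a t'" "0 \<le> p t" "0 \<le> p t'"
    using t a_nonneg p_nonneg by auto
  let ?o = "overtake L (p t) (p t')"
  have o1: "?o \<le> real L * p t" and o2: "?o \<le> real L * p t'"
    and o3: "?o \<le> (real L * p t) * (real L * p t')"
    using overtake_le[of "p t" "p t'" L] t p_nonneg p_le by auto
  define lo where "lo = a t * min (real L * p t) (real M * a t' * ?o)"
  have "lo \<le> a t * (real L * p t)"
    unfolding lo_def using nn by (intro mult_left_mono) auto
  then have lo1: "lo \<le> real L * (a t * p t)" by (simp add: mult_ac)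
  have "lo \<le> a t * (real M * a t' * ?o)"
    unfolding lo_def using nn by (intro mult_left_mono) auto
  then have lo2: "lo \<le> real M * (a t * a t' * ?o)" by (simp add: mult_ac)
  have G: "lo \<le> G s" if s: "s \<in> \<Theta>" and u: "a t * p t \<le> a s * p s"
    and v: "a t * a t' * ?o \<le> a s * (real L * (a s * p s))"
      "a t * a t' * ?o \<le> (real L * (a s * p s)) * (real L * (a s * p s))" for s
  proof -
    have ns: "0 \<le> a s" "0 \<le> p s" using s a_nonneg p_nonneg by auto
    let ?u = "real L * (a s * p s)"
    have "a t * a t' * ?o \<le> a s * ?u * min 1 (real L * p s)"
      using v by (auto simp: min_def mult_ac)
    then have "lo \<le> real M * (a s * ?u * min 1 (real L * p s))"
      using lo2 mult_left_mono[of "a t * a t' * ?o" _ "real M"] by fastforce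
    moreover have "lo \<le> ?u"
      using lo1 mult_left_mono[OF u, of "real L"] by linarith
    ultimately show ?thesis
      unfolding G_def min_def by (auto simp: mult_ac)
  qed
  have Gn: "0 \<le> G s" if "s \<in> \<Theta>" for s
    unfolding G_def using that a_nonneg[OF that] p_nonneg[OF that] by simp
  show ?thesis
  proof (cases "a t' * p t' \<le> a t * p t")
    case True
    have "lo \<le> G t"
    proof (rule G)
      have "a t * a t' * ?o \<le> a t * a t' * (real L * p t')"
        using o2 nn by (intro mult_left_mono) auto
      also have "\<dots> = a t * real L * (a t' * p t')" by simp
      also have "\<dots> \<le> a t * real L * (a t * p t)" using True nn by (intro mult_left_mono) auto
      finally show "a t * a t' * ?o \<le> a t * (real L * (a t * p t))" by simp
      have "a t * a t' * ?o \<le> a t * a t' * ((real L * p t) * (real L * p t'))"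
        using o3 nn by (intro mult_left_mono) auto
      also have "\<dots> = (real L * (a t * p t)) * real L * (a t' * p t')" by simp
      also have "\<dots> \<le> (real L * (a t * p t)) * real L * (a t * p t)"
        using True nn by (intro mult_left_mono) auto
      finally show "a t * a t' * ?o \<le> (real L * (a t * p t)) * (real L * (a t * p t))" by simp
    qed (use t in auto)
    then show ?thesis using Gn[OF t(2)] by (simp add: lo_def)
  next
    case False
    then have le: "a t * p t \<le> a t' * p t'" by simp
    have "lo \<le> G t'"
    proof (rule G)
      have "a t * a t' * ?o \<le> a t * a t' * (real L * p t)"
        using o1 nn by (intro mult_left_mono) auto
      also have "\<dots> = a t' * real L * (a t * p t)" by simp
      also have "\<dots> \<le> a t' * real L * (a t' * p t')" using le nn by (intro mult_left_mono) auto
      finally show "a t * a t' * ?o \<le> a t' * (real L * (a t' * p t'))" by simp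
      have "a t * a t' * ?o \<le> a t * a t' * ((real L * p t) * (real L * p t'))"
        using o3 nn by (intro mult_left_mono) auto
      also have "\<dots> = (real L * (a t' * p t')) * real L * (a t * p t)" by simp
      also have "\<dots> \<le> (real L * (a t' * p t')) * real L * (a t' * p t')"
        using le nn by (intro mult_left_mono) auto
      finally show "a t * a t' * ?o \<le> (real L * (a t' * p t')) * (real L * (a t' * p t'))" by simp
    qed (use t le in auto)
    then show ?thesis using Gn[OF t(1)] by (simp add: lo_def)
  qed
qed

text \<open>The union bound over competitors is split by component, each \<open>t'\<close> keeping
  its own cap 1. Then each pair of components contributes at most the mean \<open>L * p t\<close>
  (by the cap) and at most \<open>M * a t' * overtake\<close>, before weighting by
  \<open>a t\<close>. Summing \<open>G t + G t'\<close> over all pairs gives the factor 2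
  \<open>card \<Theta>\<close>.\<close>

lemma race_le:
  "race L M mass \<le> 2 * real (card \<Theta>) *
     (\<Sum>t\<in>\<Theta>. real L * (a t * p t) * min 1 (real M * a t * min 1 (real L * p t)))"
proof -
  define G where "G t = real L * (a t * p t) * min 1 (real M * a t * min 1 (real L * p t))" for t
  have q: "1 - (1 - (\<Sum>j\<in>{k..L}. mass j)) ^ (M - 1) \<le> (\<Sum>t'\<in>\<Theta>. min 1 (real M * a t' * tail t' k))" for k
  proof -
    have "1 - (1 - (\<Sum>j\<in>{k..L}. mass j)) ^ (M - 1) \<le> min 1 (real (M - 1) * (\<Sum>j\<in>{k..L}. mass j))"
      by (intro one_minus_power_le mass_tail_nonneg mass_tail_le_one)
    also have "\<dots> \<le> min 1 (real M * (\<Sum>j\<in>{k..L}. mass j))"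
      by (intro min.mono order_refl mult_right_mono mass_tail_nonneg) auto
    also have "\<dots> = min 1 (\<Sum>t'\<in>\<Theta>. real M * a t' * tail t' k)"
      unfolding mass_tail by (simp add: sum_distrib_left mult_ac)
    also have "\<dots> \<le> (\<Sum>t'\<in>\<Theta>. min 1 (real M * a t' * tail t' k))"
      by (intro min_one_sum_le finite_\<Theta> mult_nonneg_nonneg tail_nonneg a_nonneg) auto
    finally show ?thesis .
  qed
  have "race L M mass \<le> (\<Sum>k\<le>L. mass k * (real k * (\<Sum>t'\<in>\<Theta>. min 1 (real M * a t' * tail t' k))))"
    unfolding race_def by (intro sum_mono mult_left_mono q mass_nonneg) auto
  also have "\<dots> = (\<Sum>k\<le>L. \<Sum>t\<in>\<Theta>. \<Sum>t'\<in>\<Theta>. a t * (Bernstein L k (p t) * (real k * min 1 (real M * a t' * tail t' k))))"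
    unfolding mass_def by (simp add: sum_distrib_left sum_distrib_right mult_ac) (subst sum.swap, simp)
  also have "\<dots> = (\<Sum>t\<in>\<Theta>. \<Sum>k\<le>L. \<Sum>t'\<in>\<Theta>. a t * (Bernstein L k (p t) * (real k * min 1 (real M * a t' * tail t' k))))"
    by (rule sum.swap)
  also have "\<dots> = (\<Sum>t\<in>\<Theta>. \<Sum>t'\<in>\<Theta>. a t * (\<Sum>k\<le>L. Bernstein L k (p t) * (real k * min 1 (real M * a t' * tail t' k))))"
    unfolding sum_distrib_left by (intro sum.cong refl sum.swap)
  also have "\<dots> \<le> (\<Sum>t\<in>\<Theta>. \<Sum>t'\<in>\<Theta>. G t + G t')"
  proof (intro sum_mono)
    fix t t' assume t: "t \<in> \<Theta>" "t' \<in> \<Theta>"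
    let ?S = "\<Sum>k\<le>L. Bernstein L k (p t) * (real k * min 1 (real M * a t' * tail t' k))"
    have "?S \<le> (\<Sum>k\<le>L. Bernstein L k (p t) * (real k * 1))"
      using t by (intro sum_mono mult_left_mono Bern_nonneg) auto
    also have "\<dots> = real L * p t"
      using sum_k_Bernstein[of L "p t"] by (simp add: mult_ac)
    finally have 1: "?S \<le> real L * p t" .
    have "?S \<le> (\<Sum>k\<le>L. Bernstein L k (p t) * (real k * (real M * a t' * tail t' k)))"
      using t by (intro sum_mono mult_left_mono Bern_nonneg) auto
    also have "\<dots> = real M * a t' * overtake L (p t) (p t')"
      unfolding overtake_tail by (simp add: sum_distrib_left mult_ac)
    finally have "?S \<le> min (real L * p t) (real M * a t' * overtake L (p t) (p t'))"
      using 1 by simp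
    then have "a t * ?S \<le> a t * min (real L * p t) (real M * a t' * overtake L (p t) (p t'))"
      using t a_nonneg by (intro mult_left_mono) auto
    also have "\<dots> \<le> G t + G t'"
      unfolding G_def using t by (rule component_pair_le)
    finally show "a t * ?S \<le> G t + G t'" .
  qed
  also have "\<dots> = 2 * real (card \<Theta>) * (\<Sum>t\<in>\<Theta>. G t)"
    by (simp add: sum.distrib sum_distrib_left mult.assoc)
  finally show ?thesis by (simp add: G_def)
qed

text \<open>Only component \<open>t\<close> is kept, both for the sent message and for its
  competitors. The constant 16 is 8 from \<open>overtake_self_ge\<close> times 2 from
  \<open>one_minus_power_ge\<close>.\<close>

lemma race_ge:
  assumes t: "t \<in> \<Theta>"
  shows "real L * (a t * p t) * min 1 (real (M - 1) * a t * min 1 (real L * p t)) / 16 \<le> race L M mass"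
proof -
  define \<nu> where "\<nu> = min 1 (real L * p t)"
  define c where "c = min 1 (real (M - 1) * a t * \<nu>)"
  have nn: "0 \<le> a t" "0 \<le> p t" "p t \<le> 1" using t a_nonneg p_nonneg p_le by auto
  have \<nu>: "0 \<le> \<nu>" using nn by (simp add: \<nu>_def)
  have c: "0 \<le> c" using nn \<nu> by (simp add: c_def)
  have aB: "a t * Bernstein L k (p t) \<le> mass k" for k
    unfolding mass_def using t
    by (intro member_le_sum mult_nonneg_nonneg a_nonneg Bern_nonneg finite_\<Theta>) auto
  have tail\<nu>: "tail t k \<le> \<nu>" if "1 \<le> k" for k
  proof -
    have "tail t k \<le> (\<Sum>j\<le>L. real j * Bernstein L j (p t))"
    proof -
      have "tail t k \<le> (\<Sum>j\<in>{k..L}. real j * Bernstein L j (p t))"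
        unfolding tail_def
      proof (rule sum_mono)
        fix j assume "j \<in> {k..L}"
        then have "1 \<le> real j" using that by simp
        then show "Bernstein L j (p t) \<le> real j * Bernstein L j (p t)"
          using mult_right_mono[of 1 "real j"] Bern_nonneg[OF t, of j] by simp
      qed
      also have "\<dots> \<le> (\<Sum>j\<le>L. real j * Bernstein L j (p t))"
        by (intro sum_mono2) (auto intro!: mult_nonneg_nonneg Bern_nonneg t)
      finally show ?thesis .
    qed
    then show ?thesis using tail_le_one[OF t] by (simp add: \<nu>_def)
  qed
  \<comment> \<open>Linearisation by concavity: on [0,\<nu>] the function s -> min 1 ((M-1) a s)
    lies above its chord from 0, whose slope is c/\<nu>. For k >= 1 the tail lies in this interval
    by Markov's inequality.\<close>
  have key: "c * tail t k \<le> 2 * \<nu> * (1 - (1 - (\<Sum>j\<in>{k..L}. mass j)) ^ (M - 1))" if k: "1 \<le> k" for k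
  proof -
    let ?q = "\<Sum>j\<in>{k..L}. mass j"
    have "a t * tail t k \<le> ?q"
      unfolding mass_tail using t
      by (intro member_le_sum mult_nonneg_nonneg a_nonneg tail_nonneg finite_\<Theta>) auto
    then have "real (M - 1) * (a t * tail t k) \<le> real (M - 1) * ?q"
      by (intro mult_left_mono) auto
    then have "min 1 (real (M - 1) * (a t * tail t k)) / 2 \<le> min 1 (real (M - 1) * ?q) / 2"
      by auto
    also have "\<dots> \<le> 1 - (1 - ?q) ^ (M - 1)"
      by (intro one_minus_power_ge mass_tail_nonneg mass_tail_le_one)
    finally have 1: "min 1 (real (M - 1) * (a t * tail t k)) / 2 \<le> 1 - (1 - ?q) ^ (M - 1)" .
    have "c * tail t k \<le> \<nu> * min 1 (real (M - 1) * (a t * tail t k))"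
    proof -
      have "c * tail t k \<le> 1 * tail t k"
        using tail_nonneg[OF t] by (intro mult_right_mono) (auto simp: c_def)
      then have "c * tail t k \<le> \<nu> * 1" using tail\<nu>[OF k] by simp
      moreover have "c * tail t k \<le> real (M - 1) * a t * \<nu> * tail t k"
        using tail_nonneg[OF t] by (intro mult_right_mono) (auto simp: c_def)
      ultimately show ?thesis by (auto simp: min_def mult_ac)
    qed
    also have "\<dots> \<le> \<nu> * (2 * (1 - (1 - ?q) ^ (M - 1)))"
      using 1 \<nu> by (intro mult_left_mono) auto
    finally show ?thesis by (simp add: algebra_simps)
  qed
  have "a t * c * overtake L (p t) (p t) =
      (\<Sum>k\<le>L. a t * Bernstein L k (p t) * (real k * (c * tail t k)))"
    unfolding overtake_tail by (simp add: sum_distrib_left mult_ac)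
  also have "\<dots> \<le> (\<Sum>k\<le>L. mass k * (real k * (2 * \<nu> * (1 - (1 - (\<Sum>j\<in>{k..L}. mass j)) ^ (M - 1)))))"
  proof (rule sum_mono)
    fix k
    have "a t * Bernstein L k (p t) * (real k * (c * tail t k)) \<le> mass k * (real k * (c * tail t k))"
      using c tail_nonneg[OF t] by (intro mult_right_mono aB) auto
    \<comment> \<open>The term k = 0, which \<open>key\<close> does not cover, vanishes through the
      factor \<open>real k\<close>.\<close>
    also have "\<dots> \<le> mass k * (real k * (2 * \<nu> * (1 - (1 - (\<Sum>j\<in>{k..L}. mass j)) ^ (M - 1))))"
      using key[of k] by (cases "k = 0") (auto intro!: mult_left_mono mass_nonneg)
    finally show "a t * Bernstein L k (p t) * (real k * (c * tail t k)) \<le>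
      mass k * (real k * (2 * \<nu> * (1 - (1 - (\<Sum>j\<in>{k..L}. mass j)) ^ (M - 1))))" .
  qed
  also have "\<dots> = 2 * \<nu> * race L M mass"
    unfolding race_def sum_distrib_left by (intro sum.cong refl) (simp only: mult_ac)
  finally have le: "a t * c * overtake L (p t) (p t) \<le> 2 * \<nu> * race L M mass" .
  have "a t * c * (real L * p t * \<nu> / 8) \<le> a t * c * overtake L (p t) (p t)"
    using overtake_self_ge[of "p t" L] nn c unfolding \<nu>_def by (intro mult_left_mono) auto
  with le have "a t * c * (real L * p t * \<nu> / 8) \<le> 2 * \<nu> * race L M mass" by linarith
  then have "\<nu> * (a t * c * (real L * p t) / 16) \<le> \<nu> * race L M mass"
    by (simp add: mult_ac)
  \<comment> \<open>To cancel \<nu>: if it is 0, the left-hand side of the goal vanishes and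
    nonnegativity of \<open>race\<close> is enough.\<close>
  moreover have "\<nu> = 0 \<Longrightarrow> real L * p t = 0" by (auto simp: \<nu>_def min_def split: if_splits)
  moreover have "0 \<le> race L M mass"
    unfolding race_def
    using mass_tail_nonneg mass_tail_le_one
    by (intro sum_nonneg mult_nonneg_nonneg mass_nonneg) (auto intro!: power_le_one)
  ultimately have "a t * c * (real L * p t) / 16 \<le> race L M mass"
    using \<nu> by (cases "\<nu> = 0") auto
  then show ?thesis by (simp add: c_def \<nu>_def mult_ac)
qed

end

section \<open>Reduction to independent cloud counts\<close>

lemma sum_PiE_curry:
  "(\<Sum>h\<in>PiE (A \<times> B) (\<lambda>_. S). F h) =
   (\<Sum>g\<in>PiE A (\<lambda>_. PiE B (\<lambda>_. S)). F (\<lambda>p. if p \<in> A \<times> B then g (fst p) (snd p) else undefined))"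
proof -
  \<comment> \<open>Elements of \<open>PiE\<close> are \<open>undefined\<close> outside their
    domain, so uncurrying has to restore that value for the two maps to be inverse to each
    other.\<close>
  let ?i = "\<lambda>g p. if p \<in> A \<times> B then g (fst p) (snd p) else undefined"
  let ?j = "\<lambda>h. restrict (\<lambda>a. restrict (\<lambda>b. h (a, b)) B) A"
  have ij: "?i (?j h) = h" if "h \<in> PiE (A \<times> B) (\<lambda>_. S)" for h
  proof
    fix p show "?i (?j h) p = h p"
      by (cases "p \<in> A \<times> B") (auto simp: PiE_arb[OF that])
  qed
  show ?thesis
  proof (rule sum.reindex_bij_witness[where i = ?i and j = ?j])
    fix g assume g: "g \<in> PiE A (\<lambda>_. PiE B (\<lambda>_. S))"
    show "?j (?i g) = g"
    proof
      fix a show "?j (?i g) a = g a"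
      proof (cases "a \<in> A")
        case True
        then have ga: "g a \<in> PiE B (\<lambda>_. S)" using g by (rule PiE_mem[rotated])
        show ?thesis
        proof
          fix b show "?j (?i g) a b = g a b"
            using True PiE_arb[OF ga, of b] by (cases "b \<in> B") simp_all
        qed
      qed (simp add: PiE_arb[OF g])
    qed
    show "?i g \<in> PiE (A \<times> B) (\<lambda>_. S)"
    proof (rule PiE_I)
      fix p assume "p \<in> A \<times> B"
      then show "?i g p \<in> S" using PiE_mem[OF PiE_mem[OF g, of "fst p"], of "snd p"] by (simp add: mem_Times_iff)
    qed simp
  next
    fix h assume h: "h \<in> PiE (A \<times> B) (\<lambda>_. S)"
    show "?i (?j h) = h" using h by (rule ij)
    show "?j h \<in> PiE A (\<lambda>_. PiE B (\<lambda>_. S))"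
      using PiE_mem[OF h] by (simp add: restrict_PiE_iff)
    show "F (?i (?j h)) = F h" by (simp only: ij[OF h])
  qed
qed

definition seqs :: "nat \<Rightarrow> (nat \<Rightarrow> 'a) set" where
  "seqs n = PiE {..<n} (\<lambda>_. UNIV)"

lemma finite_seqs [simp, intro]: "finite (seqs n :: (nat \<Rightarrow> 'a::finite) set)"
  by (auto simp: seqs_def intro!: finite_PiE)

lemma seqs_eqI: "x \<in> seqs n \<Longrightarrow> y \<in> seqs n \<Longrightarrow> (\<And>i. i < n \<Longrightarrow> x i = y i) \<Longrightarrow> x = y"
  unfolding seqs_def by (rule PiE_ext) auto

lemma restrict_seqs [simp]: "restrict x {..<n} \<in> seqs n"
  by (simp add: seqs_def)

lemma sum_seqs_prod:
  fixes f :: "nat \<Rightarrow> 'a::finite \<Rightarrow> real"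
  shows "(\<Sum>x\<in>seqs n. \<Prod>i<n. f i (x i)) = (\<Prod>i<n. \<Sum>a\<in>UNIV. f i a)"
  unfolding seqs_def by (intro prod_sum_PiE[symmetric]) auto

text \<open>Independence of the rows of \<open>h\<close>: the expectation of a product of functions
  of one row each factorises. It serves both for the clouds, where a row is indexed by pairs (l,i),
  and for the codewords.\<close>

lemma sum_PiE_blocks:
  fixes w :: "'m \<Rightarrow> 'q \<Rightarrow> 's::finite \<Rightarrow> real"
  assumes "finite A" "finite B"
  shows "(\<Sum>h\<in>PiE (A \<times> B) (\<lambda>_. UNIV). (\<Prod>p\<in>A \<times> B. w (fst p) (snd p) (h p)) *
      (\<Prod>m\<in>A. f m (restrict (\<lambda>q. h (m, q)) B))) =
    (\<Prod>m\<in>A. \<Sum>g\<in>PiE B (\<lambda>_. UNIV). (\<Prod>q\<in>B. w m q (g q)) * f m g)"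
proof -
  let ?u = "\<lambda>g p. if p \<in> A \<times> B then g (fst p) (snd p) else undefined"
  have "(\<Sum>h\<in>PiE (A \<times> B) (\<lambda>_. UNIV). (\<Prod>p\<in>A \<times> B. w (fst p) (snd p) (h p)) *
      (\<Prod>m\<in>A. f m (restrict (\<lambda>q. h (m, q)) B))) =
    (\<Sum>g\<in>PiE A (\<lambda>_. PiE B (\<lambda>_. UNIV)). \<Prod>m\<in>A. (\<Prod>q\<in>B. w m q (g m q)) * f m (g m))"
    unfolding sum_PiE_curry
  proof (rule sum.cong[OF refl])
    fix g :: "'m \<Rightarrow> 'q \<Rightarrow> 's" assume g: "g \<in> PiE A (\<lambda>_. PiE B (\<lambda>_. UNIV))"
    have "(\<Prod>p\<in>A \<times> B. w (fst p) (snd p) (?u g p)) = (\<Prod>m\<in>A. \<Prod>q\<in>B. w m q (g m q))"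
      unfolding prod.cartesian_product by (intro prod.cong) auto
    moreover have "restrict (\<lambda>q. ?u g (m, q)) B = g m" if "m \<in> A" for m
    proof -
      have "g m \<in> PiE B (\<lambda>_. UNIV)" using g that by auto
      then show ?thesis using that by (auto simp: fun_eq_iff restrict_def PiE_iff extensional_def)
    qed
    ultimately show "(\<Prod>p\<in>A \<times> B. w (fst p) (snd p) (?u g p)) *
        (\<Prod>m\<in>A. f m (restrict (\<lambda>q. ?u g (m, q)) B)) =
        (\<Prod>m\<in>A. (\<Prod>q\<in>B. w m q (g m q)) * f m (g m))"
      by (simp add: prod.distrib)
  qed
  also have "\<dots> = (\<Prod>m\<in>A. \<Sum>g\<in>PiE B (\<lambda>_. UNIV). (\<Prod>q\<in>B. w m q (g q)) * f m g)"
    using assms by (intro prod_sum_PiE[symmetric]) (auto intro!: finite_PiE)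
  finally show ?thesis .
qed

section \<open>Expectation over codebook and channel instance\<close>

definition ensemble_mean ::
  "('x::finite \<Rightarrow> real) \<Rightarrow> ('x \<Rightarrow> 'y::finite \<Rightarrow> real) \<Rightarrow> nat \<Rightarrow> nat \<Rightarrow> nat \<Rightarrow>
     ((nat \<times> nat \<times> nat \<Rightarrow> 'y) \<Rightarrow> real) \<Rightarrow> real" where
  "ensemble_mean P W n M L F =
     (\<Sum>C \<in> PiE ({..<M} \<times> {..<n}) (\<lambda>_. UNIV). (\<Prod>p \<in> {..<M} \<times> {..<n}. P (C p)) *
        (\<Sum>Y \<in> PiE ({..<M} \<times> {..<L} \<times> {..<n}) (\<lambda>_. UNIV).
           (\<Prod>p \<in> {..<M} \<times> {..<L} \<times> {..<n}. W (C (fst p, snd (snd p))) (Y p)) * F Y))"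

lemma ensemble_mean_sum:
  "ensemble_mean P W n M L (\<lambda>Y. \<Sum>i\<in>I. F i Y) = (\<Sum>i\<in>I. ensemble_mean P W n M L (F i))"
  unfolding ensemble_mean_def sum_distrib_left
  by (subst sum.swap[of _ I], subst sum.swap[of _ I]) (rule refl)

lemma ensemble_mean_cmult:
  "ensemble_mean P W n M L (\<lambda>Y. c * F Y) = c * ensemble_mean P W n M L F"
  unfolding ensemble_mean_def sum_distrib_left by (intro sum.cong refl) (simp add: mult_ac)

lemma ensemble_mean_diff:
  "ensemble_mean P W n M L (\<lambda>Y. F Y - G Y) = ensemble_mean P W n M L F - ensemble_mean P W n M L G"
  unfolding ensemble_mean_def by (simp add: sum_subtractf right_diff_distrib)

text \<open>Grouping the cloud indices by the word they carry replaces the random index by a fixed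
  output word weighted with its multiplicity, which can then be analysed one word at a time.\<close>

lemma sum_cloud_vec:
  fixes Y :: "nat \<times> nat \<times> nat \<Rightarrow> 'y::finite"
  shows "(\<Sum>j<L. g (cloud_vec Y n m j)) =
     (\<Sum>v\<in>seqs n. real (cloud_count Y n L m (map v [0..<n])) * g (map v [0..<n]))"
proof -
  let ?r = "\<lambda>j. restrict (\<lambda>i. Y (m, j, i)) {..<n}"
  have eq: "?r j = v \<longleftrightarrow> cloud_vec Y n m j = map v [0..<n]" if "v \<in> seqs n" for j v
  proof
    assume "?r j = v"
    then show "cloud_vec Y n m j = map v [0..<n]" by (auto simp: cloud_vec_def)
  next
    assume "cloud_vec Y n m j = map v [0..<n]"
    then have "Y (m, j, i) = v i" if "i < n" for i
      using that by (simp add: cloud_vec_def)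
    then show "?r j = v" using that by (intro seqs_eqI[where n = n]) auto
  qed
  have "(\<Sum>j<L. g (cloud_vec Y n m j)) =
      (\<Sum>v\<in>seqs n. \<Sum>j\<in>{j\<in>{..<L}. ?r j = v}. g (cloud_vec Y n m j))"
    by (rule sum.group[symmetric]) auto
  also have "\<dots> = (\<Sum>v\<in>seqs n. real (cloud_count Y n L m (map v [0..<n])) * g (map v [0..<n]))"
  proof (rule sum.cong[OF refl])
    fix v :: "nat \<Rightarrow> 'y" assume v: "v \<in> seqs n"
    have "(\<Sum>j\<in>{j\<in>{..<L}. ?r j = v}. g (cloud_vec Y n m j)) =
        (\<Sum>j\<in>{j\<in>{..<L}. cloud_vec Y n m j = map v [0..<n]}. g (map v [0..<n]))"
      using eq[OF v] by (intro sum.cong) auto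
    then show "(\<Sum>j\<in>{j\<in>{..<L}. ?r j = v}. g (cloud_vec Y n m j)) =
        real (cloud_count Y n L m (map v [0..<n])) * g (map v [0..<n])"
      by (simp add: cloud_count_def)
  qed
  finally show ?thesis .
qed

text \<open>A tie counts as a defeat. This replaces random tie-breaking and ranges over 0 and 1
  only.\<close>

definition beaten :: "(nat \<times> nat \<times> nat \<Rightarrow> 'y) \<Rightarrow> nat \<Rightarrow> nat \<Rightarrow> nat \<Rightarrow> nat \<Rightarrow> 'y list \<Rightarrow> real" where
  "beaten Y n M L m v =
     of_bool (\<exists>m'\<in>{..<M} - {m}. cloud_count Y n L m v \<le> cloud_count Y n L m' v)"

text \<open>If no competitor reaches the count of \<open>m\<close>, then \<open>m\<close> is the
  unique maximiser and the error is 0. Otherwise either \<open>m\<close> is not a maximiser and the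
  error is 1, or a competitor ties with it and the error is at least 1/2.\<close>

lemma ml_error_bounds:
  assumes m: "m < M"
  shows "beaten Y n M L m (cloud_vec Y n m j) / 2 \<le> ml_error Y n M L m j"
    "ml_error Y n M L m j \<le> beaten Y n M L m (cloud_vec Y n m j)"
proof -
  define c where "c m' = cloud_count Y n L m' (cloud_vec Y n m j)" for m'
  define best where "best = {m' \<in> {..<M}. \<forall>m'' \<in> {..<M}. c m'' \<le> c m'}"
  have fin: "finite best" by (simp add: best_def)
  have err: "ml_error Y n M L m j = 1 - (if m \<in> best then 1 / real (card best) else 0)"
    by (simp add: ml_error_def best_def c_def Let_def)
  have bt: "beaten Y n M L m (cloud_vec Y n m j) = of_bool (\<exists>m'\<in>{..<M} - {m}. c m \<le> c m')"
    by (simp add: beaten_def c_def)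
  have "beaten Y n M L m (cloud_vec Y n m j) / 2 \<le> ml_error Y n M L m j \<and>
    ml_error Y n M L m j \<le> beaten Y n M L m (cloud_vec Y n m j)"
  proof (cases "\<exists>m'\<in>{..<M} - {m}. c m \<le> c m'")
    case False
    then have lt: "c m' < c m" if "m' < M" "m' \<noteq> m" for m'
      using that by (auto simp: not_le)
    have "c m'' \<le> c m" if "m'' < M" for m''
      using lt[OF that] by (cases "m'' = m") auto
    moreover have "x = m" if "x \<in> best" for x
    proof -
      have "x < M" "c m \<le> c x" using that m by (auto simp: best_def)
      then show ?thesis using lt[of x] by fastforce
    qed
    ultimately have "best = {m}" using m by (auto simp: best_def)
    then show ?thesis using False by (simp add: err bt)
  next
    case True
    then obtain m' where m': "m' < M" "m' \<noteq> m" "c m \<le> c m'" by auto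
    have "1 / real (card best) \<le> 1 / 2" if "m \<in> best"
    proof -
      have "c m'' \<le> c m'" if "m'' < M" for m''
        using \<open>m \<in> best\<close> m' that by (force simp: best_def)
      then have "m' \<in> best" using m' by (auto simp: best_def)
      then have "card {m, m'} \<le> card best"
        using that by (intro card_mono fin) auto
      then show ?thesis using m' by (simp add: field_simps)
    qed
    then show ?thesis using True by (auto simp: err bt)
  qed
  then show "beaten Y n M L m (cloud_vec Y n m j) / 2 \<le> ml_error Y n M L m j"
    "ml_error Y n M L m j \<le> beaten Y n M L m (cloud_vec Y n m j)" by auto
qed

text \<open>The left-hand side becomes a combination of products with one factor per message, the
  form that independence of the clouds can handle. Given count k, being beaten is the complement of
  all other counts lying below k; only the summand with k equal to the count of \<open>m\<close>
  survives.\<close>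

lemma count_times_beaten:
  assumes m: "m < M"
  shows "real (cloud_count Y n L m v) * beaten Y n M L m v =
    (\<Sum>k\<le>L. real k * ((\<Prod>m'<M. if m' = m then of_bool (cloud_count Y n L m' v = k) else 1) -
       (\<Prod>m'<M. if m' = m then of_bool (cloud_count Y n L m' v = k)
                 else of_bool (cloud_count Y n L m' v < k))))"
proof -
  let ?c = "\<lambda>m. cloud_count Y n L m v"
  have c: "?c m \<le> L"
  proof -
    have "?c m \<le> card {..<L}" unfolding cloud_count_def by (intro card_mono) auto
    then show ?thesis by simp
  qed
  have split: "(\<Prod>m'<M. f m') = f m * (\<Prod>m'\<in>{..<M} - {m}. f m')" for f :: "nat \<Rightarrow> real"
    using m by (intro prod.remove) auto
  have ind: "(\<Prod>m'\<in>{..<M} - {m}. of_bool (?c m' < k)) = (of_bool (\<forall>m'\<in>{..<M} - {m}. ?c m' < k) :: real)" for k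
    by (auto intro: prod_zero simp: prod_zero_iff)
  have t: "(\<Prod>m'<M. if m' = m then of_bool (?c m' = k) else 1) -
       (\<Prod>m'<M. if m' = m then of_bool (?c m' = k) else of_bool (?c m' < k)) =
       (if k = ?c m then beaten Y n M L m v else 0)" for k
  proof -
    have "(\<Prod>m'\<in>{..<M} - {m}. if m' = m then of_bool (?c m' = k) else of_bool (?c m' < k)) =
       (of_bool (\<forall>m'\<in>{..<M} - {m}. ?c m' < k) :: real)"
      unfolding ind[symmetric] by (intro prod.cong) auto
    then show ?thesis
      unfolding split by (auto simp: beaten_def not_less)
  qed
  show ?thesis unfolding t using c by (simp add: if_distrib[of "\<lambda>x. _ * x"] cong: if_cong)
qed

section \<open>The exact law of the cloud counts\<close>

locale channel =
  fixes P :: "'x::finite \<Rightarrow> real" and W :: "'x \<Rightarrow> 'y::finite \<Rightarrow> real"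
  assumes P_nonneg: "0 \<le> P x" and P_sum: "(\<Sum>x\<in>UNIV. P x) = 1"
    and W_nonneg: "0 \<le> W x y" and W_sum: "(\<Sum>y\<in>UNIV. W x y) = 1"
begin

definition Pn :: "nat \<Rightarrow> (nat \<Rightarrow> 'x) \<Rightarrow> real" where
  "Pn n x = (\<Prod>i<n. P (x i))"

definition Wn :: "nat \<Rightarrow> (nat \<Rightarrow> 'x) \<Rightarrow> (nat \<Rightarrow> 'y) \<Rightarrow> real" where
  "Wn n x y = (\<Prod>i<n. W (x i) (y i))"

lemma Pn_nonneg: "0 \<le> Pn n x" and Wn_nonneg: "0 \<le> Wn n x y"
  by (auto simp: Pn_def Wn_def P_nonneg W_nonneg intro: prod_nonneg)

lemma Pn_sum: "(\<Sum>x\<in>seqs n. Pn n x) = 1"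
  unfolding Pn_def sum_seqs_prod[of "\<lambda>_. P"] by (simp add: P_sum)

lemma Wn_sum: "(\<Sum>y\<in>seqs n. Wn n x y) = 1"
  unfolding Wn_def sum_seqs_prod[of "\<lambda>i. W (x i)"] by (simp add: W_sum)

lemma W_le_one: "W x y \<le> 1"
  using member_le_sum[of y UNIV "W x"] W_nonneg W_sum by simp

text \<open>The law of the number of copies of \<open>v\<close> in the cloud of one random codeword.\<close>

definition count_mass :: "nat \<Rightarrow> nat \<Rightarrow> (nat \<Rightarrow> 'y) \<Rightarrow> nat \<Rightarrow> real" where
  "count_mass n L v k = (\<Sum>x\<in>seqs n. Pn n x * Bernstein L k (Wn n x v))"

lemma count_mass_sum: "(\<Sum>k\<le>L. count_mass n L v k) = 1"
  unfolding count_mass_def by (subst sum.swap) (simp add: Pn_sum flip: sum_distrib_left)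

text \<open>For a fixed codeword the cloud consists of \<open>L\<close> independent words of law
  \<open>Wn n x\<close>, so \<open>sum_PiE_count\<close> applies with whole words as
  letters.\<close>

lemma cloud_sum:
  assumes v: "v \<in> seqs n"
  shows "(\<Sum>h\<in>PiE ({..<L} \<times> {..<n}) (\<lambda>_. UNIV). (\<Prod>q\<in>{..<L} \<times> {..<n}. W (x (snd q)) (h q)) *
      \<phi> (card {l\<in>{..<L}. \<forall>i<n. h (l, i) = v i})) =
    (\<Sum>k\<le>L. Bernstein L k (Wn n x v) * \<phi> k)"
proof -
  let ?u = "\<lambda>g p. if p \<in> {..<L} \<times> {..<n} then g (fst p) (snd p) else undefined"
  have "(\<Sum>h\<in>PiE ({..<L} \<times> {..<n}) (\<lambda>_. UNIV). (\<Prod>q\<in>{..<L} \<times> {..<n}. W (x (snd q)) (h q)) *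
      \<phi> (card {l\<in>{..<L}. \<forall>i<n. h (l, i) = v i})) =
    (\<Sum>g\<in>PiE {..<L} (\<lambda>_. seqs n). (\<Prod>l\<in>{..<L}. Wn n x (g l)) * \<phi> (card {l\<in>{..<L}. g l = v}))"
    unfolding sum_PiE_curry seqs_def[symmetric]
  proof (rule sum.cong[OF refl])
    fix g :: "nat \<Rightarrow> nat \<Rightarrow> 'y" assume g: "g \<in> PiE {..<L} (\<lambda>_. seqs n)"
    have "(\<Prod>q\<in>{..<L} \<times> {..<n}. W (x (snd q)) (?u g q)) = (\<Prod>l\<in>{..<L}. Wn n x (g l))"
      unfolding Wn_def prod.cartesian_product by (intro prod.cong) auto
    moreover have "(\<forall>i<n. ?u g (l, i) = v i) \<longleftrightarrow> g l = v" if "l < L" for l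
      using g v that by (auto intro: seqs_eqI)
    then have "{l\<in>{..<L}. \<forall>i<n. ?u g (l, i) = v i} = {l\<in>{..<L}. g l = v}"
      by blast
    ultimately show "(\<Prod>q\<in>{..<L} \<times> {..<n}. W (x (snd q)) (?u g q)) *
        \<phi> (card {l\<in>{..<L}. \<forall>i<n. ?u g (l, i) = v i}) =
        (\<Prod>l\<in>{..<L}. Wn n x (g l)) * \<phi> (card {l\<in>{..<L}. g l = v})"
      by simp
  qed
  also have "\<dots> = (\<Sum>k\<le>card {..<L}. Bernstein (card {..<L}) k (Wn n x v) * \<phi> k)"
    using v by (intro sum_PiE_count) (auto simp: Wn_sum)
  finally show ?thesis by simp
qed

text \<open>The counts of \<open>v\<close> in the different clouds are independent with law
  \<open>count_mass\<close>: \<open>sum_PiE_blocks\<close> is used first for the clouds given the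
  codebook, then for the codewords.\<close>

lemma ensemble_mean_prod:
  assumes v: "v \<in> seqs n"
  shows "ensemble_mean P W n M L (\<lambda>Y. \<Prod>m<M. \<phi> m (cloud_count Y n L m (map v [0..<n]))) =
    (\<Prod>m<M. \<Sum>k\<le>L. count_mass n L v k * \<phi> m k)"
proof -
  define f where "f m h = \<phi> m (card {l\<in>{..<L}. \<forall>i<n. h (l, i) = v i})" for m and h :: "nat \<times> nat \<Rightarrow> 'y"
  define H where "H m x = (\<Sum>k\<le>L. Bernstein L k (Wn n x v) * \<phi> m k)" for m x
  have cc: "\<phi> m (cloud_count Y n L m (map v [0..<n])) =
      f m (restrict (\<lambda>q. Y (m, q)) ({..<L} \<times> {..<n}))" for m Y
  proof -
    have "{l\<in>{..<L}. cloud_vec Y n m l = map v [0..<n]} =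
        {l\<in>{..<L}. \<forall>i<n. restrict (\<lambda>q. Y (m, q)) ({..<L} \<times> {..<n}) (l, i) = v i}"
      by (auto simp: cloud_vec_def)
    then show ?thesis by (simp add: cloud_count_def f_def)
  qed
  have inner: "(\<Sum>Y \<in> PiE ({..<M} \<times> {..<L} \<times> {..<n}) (\<lambda>_. UNIV).
       (\<Prod>p \<in> {..<M} \<times> {..<L} \<times> {..<n}. W (C (fst p, snd (snd p))) (Y p)) *
       (\<Prod>m<M. \<phi> m (cloud_count Y n L m (map v [0..<n])))) =
     (\<Prod>m<M. H m (restrict (\<lambda>i. C (m, i)) {..<n}))" for C :: "nat \<times> nat \<Rightarrow> 'x"
  proof -
    have "(\<Sum>Y \<in> PiE ({..<M} \<times> {..<L} \<times> {..<n}) (\<lambda>_. UNIV).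
       (\<Prod>p \<in> {..<M} \<times> {..<L} \<times> {..<n}. W (C (fst p, snd (snd p))) (Y p)) *
       (\<Prod>m<M. \<phi> m (cloud_count Y n L m (map v [0..<n])))) =
      (\<Prod>m<M. \<Sum>g\<in>PiE ({..<L} \<times> {..<n}) (\<lambda>_. UNIV). (\<Prod>q\<in>{..<L} \<times> {..<n}. W (C (m, snd q)) (g q)) * f m g)"
      unfolding cc by (rule sum_PiE_blocks[where w = "\<lambda>m q. W (C (m, snd q))"]) auto
    also have "\<dots> = (\<Prod>m<M. H m (\<lambda>i. C (m, i)))"
      unfolding f_def H_def by (intro prod.cong refl cloud_sum[OF v])
    also have "\<dots> = (\<Prod>m<M. H m (restrict (\<lambda>i. C (m, i)) {..<n}))"
      unfolding H_def Wn_def by (intro prod.cong refl sum.cong) auto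
    finally show ?thesis .
  qed
  have "ensemble_mean P W n M L (\<lambda>Y. \<Prod>m<M. \<phi> m (cloud_count Y n L m (map v [0..<n]))) =
     (\<Sum>C \<in> PiE ({..<M} \<times> {..<n}) (\<lambda>_. UNIV). (\<Prod>p \<in> {..<M} \<times> {..<n}. P (C p)) *
        (\<Prod>m<M. H m (restrict (\<lambda>i. C (m, i)) {..<n})))"
    unfolding ensemble_mean_def inner ..
  also have "\<dots> = (\<Prod>m<M. \<Sum>x\<in>PiE {..<n} (\<lambda>_. UNIV). (\<Prod>i\<in>{..<n}. P (x i)) * H m x)"
    by (rule sum_PiE_blocks[where w = "\<lambda>m q. P"]) auto
  also have "\<dots> = (\<Prod>m<M. \<Sum>k\<le>L. count_mass n L v k * \<phi> m k)"
  proof (rule prod.cong[OF refl])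
    fix m
    show "(\<Sum>x\<in>PiE {..<n} (\<lambda>_. UNIV). (\<Prod>i\<in>{..<n}. P (x i)) * H m x) = (\<Sum>k\<le>L. count_mass n L v k * \<phi> m k)"
      unfolding H_def count_mass_def seqs_def[symmetric] Pn_def[symmetric] sum_distrib_left sum_distrib_right
      by (subst sum.swap) (simp add: mult_ac)
  qed
  finally show ?thesis .
qed

text \<open>The two products of \<open>count_times_beaten\<close> have expectations beta(k) and
  beta(k) times the probability that all M-1 competitors stay below k; their difference is the
  summand of \<open>race\<close>.\<close>

lemma ensemble_mean_beaten:
  assumes v: "v \<in> seqs n" and m: "m < M"
  shows "ensemble_mean P W n M L (\<lambda>Y. real (cloud_count Y n L m (map v [0..<n])) * beaten Y n M L m (map v [0..<n])) =
    race L M (count_mass n L v)"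
proof -
  let ?\<beta> = "count_mass n L v"
  have split: "(\<Prod>m'<M. f m') = f m * (\<Prod>m'\<in>{..<M} - {m}. f m')" for f :: "nat \<Rightarrow> real"
    using m by (intro prod.remove) auto
  have c: "card ({..<M} - {m}) = M - 1" using m by simp
  have eqk: "(\<Sum>j\<le>L. ?\<beta> j * of_bool (j = k)) = ?\<beta> k" if "k \<le> L" for k
    using that by (simp add: of_bool_def if_distrib[of "\<lambda>x. _ * x"] cong: if_cong)
  have lessk: "(\<Sum>j\<le>L. ?\<beta> j * of_bool (j < k)) = 1 - (\<Sum>j\<in>{k..L}. ?\<beta> j)" if "k \<le> L" for k
  proof -
    have "(\<Sum>j\<le>L. ?\<beta> j * of_bool (j < k)) = (\<Sum>j\<in>{j\<in>{..L}. j < k}. ?\<beta> j)"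
      by (simp add: of_bool_def if_distrib[of "\<lambda>x. _ * x"] sum.If_cases Int_def cong: if_cong)
    also have "\<dots> = (\<Sum>j\<le>L. ?\<beta> j) - (\<Sum>j\<in>{k..L}. ?\<beta> j)"
      by (subst sum_diff[symmetric]) (auto intro!: sum.cong)
    finally show ?thesis by (simp add: count_mass_sum)
  qed
  define \<phi>1 where "\<phi>1 k m' j = (if m' = m then of_bool (j = k) else (1::real))" for k m' j :: nat
  define \<phi>2 where "\<phi>2 k m' j = (if m' = m then of_bool (j = k) else of_bool (j < k) :: real)" for k m' j :: nat
  have 1: "ensemble_mean P W n M L (\<lambda>Y. \<Prod>m'<M. \<phi>1 k m' (cloud_count Y n L m' (map v [0..<n]))) = ?\<beta> k"
    if "k \<le> L" for k
  proof -
    have "(\<Prod>m'\<in>{..<M} - {m}. \<Sum>j\<le>L. ?\<beta> j * \<phi>1 k m' j) = (\<Prod>m'\<in>{..<M} - {m}. 1)"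
      by (intro prod.cong) (auto simp: \<phi>1_def count_mass_sum)
    moreover have "(\<Sum>j\<le>L. ?\<beta> j * \<phi>1 k m j) = ?\<beta> k"
      unfolding \<phi>1_def using eqk[OF that] by simp
    ultimately show ?thesis
      unfolding ensemble_mean_prod[OF v] unfolding split by (simp only: prod.neutral_const mult_1_right)
  qed
  have 2: "ensemble_mean P W n M L (\<lambda>Y. \<Prod>m'<M. \<phi>2 k m' (cloud_count Y n L m' (map v [0..<n]))) =
      ?\<beta> k * (1 - (\<Sum>j\<in>{k..L}. ?\<beta> j)) ^ (M - 1)" if "k \<le> L" for k
  proof -
    have "(\<Prod>m'\<in>{..<M} - {m}. \<Sum>j\<le>L. ?\<beta> j * \<phi>2 k m' j) =
        (\<Prod>m'\<in>{..<M} - {m}. 1 - (\<Sum>j\<in>{k..L}. ?\<beta> j))"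
      unfolding \<phi>2_def by (intro prod.cong refl) (use lessk[OF that] in auto)
    moreover have "(\<Sum>j\<le>L. ?\<beta> j * \<phi>2 k m j) = ?\<beta> k"
      unfolding \<phi>2_def using eqk[OF that] by simp
    ultimately show ?thesis
      unfolding ensemble_mean_prod[OF v] unfolding split by (simp only: prod_constant c)
  qed
  have "real (cloud_count Y n L m (map v [0..<n])) * beaten Y n M L m (map v [0..<n]) =
    (\<Sum>k\<le>L. real k * ((\<Prod>m'<M. \<phi>1 k m' (cloud_count Y n L m' (map v [0..<n]))) -
       (\<Prod>m'<M. \<phi>2 k m' (cloud_count Y n L m' (map v [0..<n])))))" for Y :: "nat \<times> nat \<times> nat \<Rightarrow> 'y"
    unfolding count_times_beaten[OF m] \<phi>1_def \<phi>2_def ..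
  then show ?thesis
    unfolding race_def
    by (simp only: ensemble_mean_sum ensemble_mean_cmult ensemble_mean_diff)
      (intro sum.cong refl, simp only: 1 2 atMost_iff, simp only: algebra_simps mult_1_right)
qed

lemma ensemble_mean_mono:
  assumes "\<And>Y. F Y \<le> G Y"
  shows "ensemble_mean P W n M L F \<le> ensemble_mean P W n M L G"
  unfolding ensemble_mean_def
  by (intro sum_mono mult_left_mono assms prod_nonneg) (auto simp: P_nonneg W_nonneg)

lemma ensemble_mean_avg_beaten:
  assumes M: "0 < M"
  shows "ensemble_mean P W n M L (\<lambda>Y. (1 / real M) * (\<Sum>m<M. (1 / real L) *
      (\<Sum>j<L. beaten Y n M L m (cloud_vec Y n m j)))) =
    (1 / real L) * (\<Sum>v\<in>seqs n. race L M (count_mass n L v))"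
proof -
  have "ensemble_mean P W n M L (\<lambda>Y. (1 / real M) * (\<Sum>m<M. (1 / real L) *
      (\<Sum>j<L. beaten Y n M L m (cloud_vec Y n m j)))) =
    (1 / real M) * (\<Sum>m<M. (1 / real L) * (\<Sum>v\<in>seqs n.
      ensemble_mean P W n M L (\<lambda>Y. real (cloud_count Y n L m (map v [0..<n])) * beaten Y n M L m (map v [0..<n]))))"
    unfolding sum_cloud_vec ensemble_mean_cmult ensemble_mean_sum ..
  also have "\<dots> = (1 / real M) * (\<Sum>m<M. (1 / real L) * (\<Sum>v\<in>seqs n. race L M (count_mass n L v)))"
    by (intro arg_cong2[where f = "(*)"] sum.cong refl ensemble_mean_beaten) auto
  finally show ?thesis using M by simp
qed

lemma avg_error_prob_bounds:
  fixes R K :: real and n :: nat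
  defines "M \<equiv> num_msgs R n" and "L \<equiv> num_msgs K n"
  defines "S \<equiv> (1 / real L) * (\<Sum>v\<in>seqs n. race L M (count_mass n L v))"
  assumes M: "0 < M"
  shows "S / 2 \<le> avg_error_prob P W R K n" "avg_error_prob P W R K n \<le> S"
proof -
  have a: "avg_error_prob P W R K n =
    ensemble_mean P W n M L (\<lambda>Y. (1 / real M) * (\<Sum>m<M. (1 / real L) * (\<Sum>j<L. ml_error Y n M L m j)))"
    by (simp add: avg_error_prob_def ensemble_mean_def M_def L_def Let_def)
  have S: "S = ensemble_mean P W n M L (\<lambda>Y. (1 / real M) * (\<Sum>m<M. (1 / real L) *
      (\<Sum>j<L. beaten Y n M L m (cloud_vec Y n m j))))"
    unfolding S_def by (rule ensemble_mean_avg_beaten[OF M, symmetric])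
  show "avg_error_prob P W R K n \<le> S"
    unfolding a S by (intro ensemble_mean_mono mult_left_mono sum_mono ml_error_bounds) auto
  have half: "c * ((1 / real M) * (\<Sum>m<M. (1 / real L) * (\<Sum>j<L. b m j))) =
      (1 / real M) * (\<Sum>m<M. (1 / real L) * (\<Sum>j<L. c * b m j))" for c :: real and b
    unfolding sum_distrib_left by (intro sum.cong refl) (simp only: mult_ac)
  have "S / 2 = ensemble_mean P W n M L (\<lambda>Y. (1 / real M) * (\<Sum>m<M. (1 / real L) *
      (\<Sum>j<L. 1 / 2 * beaten Y n M L m (cloud_vec Y n m j))))"
    unfolding half[symmetric] ensemble_mean_cmult[of P W n M L "1 / 2"] S by simp
  also have "\<dots> \<le> avg_error_prob P W R K n"
    unfolding a
  proof (intro ensemble_mean_mono mult_left_mono sum_mono)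
    fix Y m j assume "m \<in> {..<M}"
    then show "1 / 2 * beaten Y n M L m (cloud_vec Y n m j) \<le> ml_error Y n M L m j"
      using ml_error_bounds(1)[of m M Y n L j] by simp
  qed auto
  finally show "S / 2 \<le> avg_error_prob P W R K n" .
qed

end

section \<open>Joint types and change of measure\<close>

text \<open>Unnormalised counts of pairs in the order (y,x) of the distributions \<open>Q\<close>;
  division by n gives the empirical distribution.\<close>

definition joint_type :: "nat \<Rightarrow> (nat \<Rightarrow> 'x) \<Rightarrow> (nat \<Rightarrow> 'y) \<Rightarrow> 'y \<times> 'x \<Rightarrow> nat" where
  "joint_type n x y z = card {i\<in>{..<n}. (y i, x i) = z}"

text \<open>A superset of the types that occur. Its size is polynomial in n, and a type realised by
  no pair of words has class mass 0.\<close>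

definition types :: "nat \<Rightarrow> ('z \<Rightarrow> nat) set" where
  "types n = PiE UNIV (\<lambda>_. {..n})"

lemma finite_types [simp, intro]: "finite (types n :: ('z::finite \<Rightarrow> nat) set)"
  by (auto simp: types_def intro!: finite_PiE)

lemma card_types: "card (types n :: ('z::finite \<Rightarrow> nat) set) = (n + 1) ^ CARD('z)"
  by (simp add: types_def card_PiE)

lemma joint_type_in_types [simp, intro]: "joint_type n x y \<in> types n"
proof -
  have "joint_type n x y z \<le> card {..<n}" for z
    unfolding joint_type_def by (intro card_mono) auto
  then show ?thesis by (auto simp: types_def)
qed

lemma sum_joint_type:
  fixes \<phi> :: "'y::finite \<times> 'x::finite \<Rightarrow> real"
  shows "(\<Sum>i<n. \<phi> (y i, x i)) = (\<Sum>z\<in>UNIV. real (joint_type n x y z) * \<phi> z)"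
proof -
  have "(\<Sum>i<n. \<phi> (y i, x i)) = (\<Sum>z\<in>UNIV. \<Sum>i\<in>{i\<in>{..<n}. (y i, x i) = z}. \<phi> (y i, x i))"
    by (rule sum.group[symmetric]) auto
  also have "\<dots> = (\<Sum>z\<in>UNIV. real (joint_type n x y z) * \<phi> z)"
  proof (rule sum.cong[OF refl])
    fix z
    have "(\<Sum>i\<in>{i\<in>{..<n}. (y i, x i) = z}. \<phi> (y i, x i)) = (\<Sum>i\<in>{i\<in>{..<n}. (y i, x i) = z}. \<phi> z)"
      by (intro sum.cong) auto
    then show "(\<Sum>i\<in>{i\<in>{..<n}. (y i, x i) = z}. \<phi> (y i, x i)) = real (joint_type n x y z) * \<phi> z"
      by (simp add: joint_type_def)
  qed
  finally show ?thesis .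
qed

lemma prod_joint_type:
  fixes f :: "'y::finite \<times> 'x::finite \<Rightarrow> real"
  shows "(\<Prod>i<n. f (y i, x i)) = (\<Prod>z\<in>UNIV. f z ^ joint_type n x y z)"
proof -
  have "(\<Prod>i<n. f (y i, x i)) = (\<Prod>z\<in>UNIV. \<Prod>i\<in>{i\<in>{..<n}. (y i, x i) = z}. f (y i, x i))"
    by (rule prod.group[symmetric]) auto
  also have "\<dots> = (\<Prod>z\<in>UNIV. f z ^ joint_type n x y z)"
  proof (rule prod.cong[OF refl])
    fix z
    have "(\<Prod>i\<in>{i\<in>{..<n}. (y i, x i) = z}. f (y i, x i)) = (\<Prod>i\<in>{i\<in>{..<n}. (y i, x i) = z}. f z)"
      by (intro prod.cong) auto
    then show "(\<Prod>i\<in>{i\<in>{..<n}. (y i, x i) = z}. f (y i, x i)) = f z ^ joint_type n x y z"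
      by (simp add: joint_type_def)
  qed
  finally show ?thesis .
qed

lemma joint_type_pos: "i < n \<Longrightarrow> 0 < joint_type n x y (y i, x i)"
  unfolding joint_type_def by (subst card_gt_0_iff) auto

lemma joint_type_posD: "0 < joint_type n x y z \<Longrightarrow> \<exists>i<n. (y i, x i) = z"
  unfolding joint_type_def by (subst (asm) card_gt_0_iff) auto

text \<open>The relation between f and g is required only at the pairs that occur, so the values of
  \<phi> off the support are immaterial. The resulting exponent depends on the words through their
  joint type alone.\<close>

lemma prod_change_of_measure:
  fixes f g \<phi> :: "'y::finite \<times> 'x::finite \<Rightarrow> real"
  assumes "\<And>i. i < n \<Longrightarrow> g (y i, x i) = f (y i, x i) * exp (- \<phi> (y i, x i))"
  shows "(\<Prod>i<n. g (y i, x i)) = (\<Prod>i<n. f (y i, x i)) *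
    exp (- (\<Sum>z\<in>UNIV. real (joint_type n x y z) * \<phi> z))"
proof -
  have "(\<Prod>i<n. g (y i, x i)) = (\<Prod>i<n. f (y i, x i) * exp (- \<phi> (y i, x i)))"
    by (intro prod.cong) (auto simp: assms)
  then show ?thesis
    by (simp add: prod.distrib exp_sum sum_negf sum_joint_type flip: exp_sum)
qed

section \<open>The error probability as a sum over joint types\<close>

context channel
begin

definition class_mass :: "nat \<Rightarrow> (nat \<Rightarrow> 'y) \<Rightarrow> ('y \<times> 'x \<Rightarrow> nat) \<Rightarrow> real" where
  "class_mass n v t = (\<Sum>x\<in>{x\<in>seqs n. joint_type n x v = t}. Pn n x)"

definition type_prob :: "('y \<times> 'x \<Rightarrow> nat) \<Rightarrow> real" where
  "type_prob t = (\<Prod>(y, x)\<in>UNIV. W x y ^ t (y, x))"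

lemma Wn_type_prob: "Wn n x v = type_prob (joint_type n x v)"
  unfolding Wn_def type_prob_def
  using prod_joint_type[of "\<lambda>(y, x). W x y" v x n] by (simp add: case_prod_unfold)

lemma class_mixture: "binomial_mixture (types n) (class_mass n v) type_prob"
proof
  show "(\<Sum>t\<in>types n. class_mass n v t) = 1"
    unfolding class_mass_def by (subst sum.group) (auto simp: Pn_sum)
  show "type_prob t \<le> 1" for t
    unfolding type_prob_def
    by (intro prod_le_1) (auto simp: W_nonneg W_le_one intro!: power_le_one)
qed (auto simp: class_mass_def type_prob_def Pn_nonneg W_nonneg intro!: sum_nonneg prod_nonneg)

text \<open>Since \<open>Wn n x v\<close> depends only on the joint type, grouping the codewords
  turns a mixture over exponentially many codewords into one with polynomially many
  components.\<close>

lemma count_mass_class: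
  "count_mass n L v = binomial_mixture.mass (types n) (class_mass n v) type_prob L"
proof
  fix k
  have "count_mass n L v k = (\<Sum>t\<in>types n. \<Sum>x\<in>{x\<in>seqs n. joint_type n x v = t}.
      Pn n x * Bernstein L k (Wn n x v))"
    unfolding count_mass_def by (rule sum.group[symmetric]) auto
  also have "\<dots> = (\<Sum>t\<in>types n. class_mass n v t * Bernstein L k (type_prob t))"
    unfolding class_mass_def sum_distrib_right
    by (intro sum.cong refl) (simp add: Wn_type_prob)
  finally show "count_mass n L v k = binomial_mixture.mass (types n) (class_mass n v) type_prob L k"
    by (simp add: binomial_mixture.mass_def[OF class_mixture])
qed

text \<open>The component bound of \<open>race_le\<close> and \<open>race_ge\<close> summed over
  output words, without its factor \<open>L\<close>, which cancels against the average over the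
  cloud. The argument \<open>M\<close> is free because the upper bound takes the number of messages
  and the lower bound one less.\<close>

definition class_error :: "nat \<Rightarrow> real \<Rightarrow> real \<Rightarrow> ('y \<times> 'x \<Rightarrow> nat) \<Rightarrow> real" where
  "class_error n M L t = (\<Sum>v\<in>seqs n. class_mass n v t * type_prob t *
     min 1 (M * class_mass n v t * min 1 (L * type_prob t)))"

lemma avg_error_prob_le_class_error:
  assumes "0 < num_msgs R n"
  shows "avg_error_prob P W R K n \<le> 2 * real (n + 1) ^ CARD('y \<times> 'x) *
    (\<Sum>t\<in>types n. class_error n (real (num_msgs R n)) (real (num_msgs K n)) t)"
proof -
  define M where "M = num_msgs R n"
  define L where "L = num_msgs K n"
  let ?G = "\<lambda>v t. class_mass n v t * type_prob t * min 1 (real M * class_mass n v t * min 1 (real L * type_prob t))"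
  have G: "0 \<le> ?G v t" if "t \<in> types n" for v t
    using binomial_mixture.a_nonneg[OF class_mixture that, of v]
      binomial_mixture.p_nonneg[OF class_mixture that] by simp
  have "avg_error_prob P W R K n \<le> (1 / real L) * (\<Sum>v\<in>seqs n. race L M (count_mass n L v))"
    unfolding M_def L_def by (rule avg_error_prob_bounds[OF assms])
  also have "\<dots> \<le> (1 / real L) * (\<Sum>v\<in>seqs n. 2 * real (n + 1) ^ CARD('y \<times> 'x) * (\<Sum>t\<in>types n. real L * ?G v t))"
    unfolding count_mass_class
  proof (intro mult_left_mono sum_mono)
    fix v
    show "race L M (binomial_mixture.mass (types n) (class_mass n v) type_prob L)
        \<le> 2 * real (n + 1) ^ CARD('y \<times> 'x) * (\<Sum>t\<in>types n. real L * ?G v t)"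
      using binomial_mixture.race_le[OF class_mixture[of n v], of L M]
      by (simp add: card_types mult.assoc)
  qed auto
  also have "\<dots> = (real L / real L) * (2 * real (n + 1) ^ CARD('y \<times> 'x) * (\<Sum>v\<in>seqs n. \<Sum>t\<in>types n. ?G v t))"
    by (simp add: sum_distrib_left[symmetric])
  \<comment> \<open>The quotient is 1, or 0 if \<open>L\<close> is 0.\<close>
  also have "\<dots> \<le> 1 * (2 * real (n + 1) ^ CARD('y \<times> 'x) * (\<Sum>v\<in>seqs n. \<Sum>t\<in>types n. ?G v t))"
    by (intro mult_right_mono mult_nonneg_nonneg[OF _ sum_nonneg[OF sum_nonneg[OF G]]]) auto
  also have "(\<Sum>v\<in>seqs n. \<Sum>t\<in>types n. ?G v t) = (\<Sum>t\<in>types n. class_error n (real M) (real L) t)"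
    unfolding class_error_def by (rule sum.swap)
  finally show ?thesis by (simp add: M_def L_def)
qed

lemma avg_error_prob_ge_class_error:
  assumes "0 < num_msgs R n" "0 < num_msgs K n" "t \<in> types n"
  shows "class_error n (real (num_msgs R n - 1)) (real (num_msgs K n)) t / 32 \<le> avg_error_prob P W R K n"
proof -
  define M where "M = num_msgs R n"
  define L where "L = num_msgs K n"
  have L: "0 < L" using assms by (simp add: L_def)
  let ?G = "\<lambda>v. class_mass n v t * type_prob t * min 1 (real (M - 1) * class_mass n v t * min 1 (real L * type_prob t))"
  \<comment> \<open>The 32 is 16 from \<open>race_ge\<close> times 2 from the treatment of
    ties.\<close>
  have "class_error n (real (M - 1)) (real L) t / 32 =
      (1 / real L) * (\<Sum>v\<in>seqs n. real L * ?G v / 16) / 2"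
    using L unfolding class_error_def by (simp add: sum_distrib_left[symmetric] sum_divide_distrib[symmetric])
  also have "\<dots> \<le> (1 / real L) * (\<Sum>v\<in>seqs n. race L M (count_mass n L v)) / 2"
    unfolding count_mass_class
  proof (intro divide_right_mono mult_left_mono sum_mono)
    fix v
    show "real L * ?G v / 16 \<le> race L M (binomial_mixture.mass (types n) (class_mass n v) type_prob L)"
      using binomial_mixture.race_ge[OF class_mixture[of n v] assms(3), of L M] by (simp add: mult.assoc)
  qed auto
  also have "\<dots> \<le> avg_error_prob P W R K n"
    unfolding M_def L_def by (rule avg_error_prob_bounds[OF assms(1)])
  finally show ?thesis by (simp add: M_def L_def)
qed

end

section \<open>Change of measure to a joint distribution on the support of \<open>P\<close> times
  \<open>W\<close>\<close>

locale tilted_channel = channel P W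
  for P :: "'x::finite \<Rightarrow> real" and W :: "'x \<Rightarrow> 'y::finite \<Rightarrow> real" +
  fixes Q :: "'y \<times> 'x \<Rightarrow> real"
  assumes joint_Q: "joint_dist Q" and abs_cont: "0 < Q (y, x) \<Longrightarrow> 0 < P x * W x y"
begin

lemma Q_nonneg: "0 \<le> Q z" and Q_sum: "(\<Sum>z\<in>UNIV. Q z) = 1"
  using joint_Q unfolding joint_dist_def by blast+

abbreviation "T \<equiv> marg_T Q"
abbreviation "V \<equiv> cond_V Q"

lemma T_nonneg: "0 \<le> T y"
  unfolding marg_T_def by (intro sum_nonneg Q_nonneg)

lemma Q_le_T: "Q (y, x) \<le> T y"
  unfolding marg_T_def by (rule member_le_sum) (auto simp: Q_nonneg)

lemma T_mult_V: "T y * V y x = Q (y, x)"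
  using Q_le_T[of y x] Q_nonneg[of "(y, x)"] by (cases "T y = 0") (auto simp: cond_V_def)

lemma T_sum: "(\<Sum>y\<in>UNIV. T y) = 1"
  using Q_sum unfolding marg_T_def sum.cartesian_product by (simp add: UNIV_Times_UNIV)

lemma V_nonneg: "0 \<le> V y x"
  unfolding cond_V_def by (intro divide_nonneg_nonneg Q_nonneg T_nonneg)

text \<open>An inequality, because division by zero makes the row \<open>V y\<close> vanish where
  \<open>T y\<close> is 0.\<close>

lemma V_sum_le: "(\<Sum>x\<in>UNIV. V y x) \<le> 1"
  unfolding cond_V_def sum_divide_distrib[symmetric] marg_T_def[symmetric] by simp

text \<open>The three functions \<phi>D, \<phi>A, \<phi>B are the single-letter log-likelihood terms
  whose means under \<open>Q\<close> are D, A and B; their sums over a type are the exact exponents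
  of its probabilities.\<close>

definition \<phi>D :: "'y \<times> 'x \<Rightarrow> real" where
  "\<phi>D z = (if 0 < Q z then ln (Q z / (P (snd z) * W (snd z) (fst z))) else 0)"

definition \<phi>A :: "'y \<times> 'x \<Rightarrow> real" where
  "\<phi>A z = (if 0 < Q z then ln (V (fst z) (snd z) / P (snd z)) else 0)"

definition \<phi>B :: "'y \<times> 'x \<Rightarrow> real" where
  "\<phi>B z = (if 0 < Q z then - ln (W (snd z) (fst z)) else 0)"

lemma div_D_eq: "div_D P W Q = (\<Sum>z\<in>UNIV. Q z * \<phi>D z)"
  unfolding div_D_def T_mult_V by (intro sum.cong refl) (auto simp: \<phi>D_def)

lemma A_TV_eq: "A_TV P Q = (\<Sum>z\<in>UNIV. Q z * \<phi>A z)"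
  unfolding A_TV_def T_mult_V by (intro sum.cong refl) (auto simp: \<phi>A_def)

lemma B_TV_eq: "B_TV W Q = (\<Sum>z\<in>UNIV. Q z * \<phi>B z)"
  unfolding B_TV_def T_mult_V by (intro sum.cong refl) (auto simp: \<phi>B_def)

lemma support_pos:
  assumes "0 < Q (y, x)"
  shows "0 < P x" "0 < W x y" "0 < V y x"
proof -
  have "0 < P x * W x y" using abs_cont assms .
  then show "0 < P x" "0 < W x y"
    using P_nonneg[of x] W_nonneg[of x y] by (auto simp: zero_less_mult_iff)
  show "0 < V y x"
    using assms Q_le_T[of y x] by (simp add: cond_V_def)
qed

lemma P_tilt: "0 < Q (y, x) \<Longrightarrow> P x = V y x * exp (- \<phi>A (y, x))"
  using support_pos[of y x] by (simp add: \<phi>A_def exp_minus)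

lemma PW_tilt: "0 < Q (y, x) \<Longrightarrow> P x * W x y = Q (y, x) * exp (- \<phi>D (y, x))"
  using support_pos[of y x] by (simp add: \<phi>D_def exp_minus)

lemma W_tilt: "0 < Q (y, x) \<Longrightarrow> W x y = 1 * exp (- \<phi>B (y, x))"
  using support_pos[of y x] by (simp add: \<phi>B_def)

definition type_sum :: "('y \<times> 'x \<Rightarrow> nat) \<Rightarrow> ('y \<times> 'x \<Rightarrow> real) \<Rightarrow> real" where
  "type_sum t \<phi> = (\<Sum>z\<in>UNIV. real (t z) * \<phi> z)"

text \<open>The counterpart of exp(-n objective) for a type: capping by 1 inside the exponentials
  corresponds to the nested positive parts.\<close>

definition type_exponent :: "('y \<times> 'x \<Rightarrow> nat) \<Rightarrow> real \<Rightarrow> real \<Rightarrow> real" where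
  "type_exponent t M L = exp (- type_sum t \<phi>D) *
     min 1 (M * exp (- type_sum t \<phi>A) * min 1 (L * exp (- type_sum t \<phi>B)))"

definition Tn :: "nat \<Rightarrow> (nat \<Rightarrow> 'y) \<Rightarrow> real" where
  "Tn n v = (\<Prod>i<n. T (v i))"

definition class_V :: "nat \<Rightarrow> (nat \<Rightarrow> 'y) \<Rightarrow> ('y \<times> 'x \<Rightarrow> nat) \<Rightarrow> real" where
  "class_V n v t = (\<Sum>x\<in>{x\<in>seqs n. joint_type n x v = t}. \<Prod>i<n. V (v i) (x i))"

lemma Tn_nonneg: "0 \<le> Tn n v"
  unfolding Tn_def by (intro prod_nonneg) (auto simp: T_nonneg)

lemma Tn_sum: "(\<Sum>v\<in>seqs n. Tn n v) = 1"
  unfolding Tn_def sum_seqs_prod[of "\<lambda>_. T"] by (simp add: T_sum)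

lemma class_V_nonneg: "0 \<le> class_V n v t"
  unfolding class_V_def by (intro sum_nonneg prod_nonneg) (auto simp: V_nonneg)

lemma class_V_le_one: "class_V n v t \<le> 1"
proof -
  have "class_V n v t \<le> (\<Sum>x\<in>seqs n. \<Prod>i<n. V (v i) (x i))"
    unfolding class_V_def by (intro sum_mono2) (auto simp: V_nonneg intro!: prod_nonneg)
  also have "\<dots> = (\<Prod>i<n. \<Sum>x\<in>UNIV. V (v i) x)"
    by (rule sum_seqs_prod)
  also have "\<dots> \<le> 1"
    by (intro prod_le_1) (auto simp: V_nonneg V_sum_le intro!: sum_nonneg)
  finally show ?thesis .
qed

context
  fixes n :: nat and t :: "'y \<times> 'x \<Rightarrow> nat"
  assumes supp: "\<And>z. 0 < t z \<Longrightarrow> 0 < Q z"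
begin

lemma Q_pos_of_type:
  assumes "joint_type n x v = t" "i < n"
  shows "0 < Q (v i, x i)"
  using joint_type_pos[OF assms(2), of x v] assms supp by simp

text \<open>By \<open>supp\<close> every letter pair of a realisation of \<open>t\<close> lies in
  the support of \<open>Q\<close>, so \<open>P\<close> can be tilted to \<open>V\<close> letter by
  letter with a factor that is constant on the class.\<close>

lemma class_mass_eq: "class_mass n v t = class_V n v t * exp (- type_sum t \<phi>A)"
  unfolding class_mass_def class_V_def sum_distrib_right
proof (rule sum.cong[OF refl])
  fix x assume "x \<in> {x \<in> seqs n. joint_type n x v = t}"
  then have x: "joint_type n x v = t" by simp
  have "(\<Prod>i<n. P (x i)) = (\<Prod>i<n. V (v i) (x i)) * exp (- type_sum t \<phi>A)"
    unfolding type_sum_def x[symmetric]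
    using prod_change_of_measure[of n "\<lambda>z. P (snd z)" v x "\<lambda>z. V (fst z) (snd z)" \<phi>A]
      P_tilt[OF Q_pos_of_type[OF x]] by simp
  then show "Pn n x = (\<Prod>i<n. V (v i) (x i)) * exp (- type_sum t \<phi>A)"
    by (simp add: Pn_def)
qed

lemma class_mass_type_prob_eq:
  "class_mass n v t * type_prob t = Tn n v * class_V n v t * exp (- type_sum t \<phi>D)"
  unfolding class_mass_def class_V_def sum_distrib_right sum_distrib_left
proof (rule sum.cong[OF refl])
  fix x assume "x \<in> {x \<in> seqs n. joint_type n x v = t}"
  then have x: "joint_type n x v = t" by simp
  have "(\<Prod>i<n. P (x i) * W (x i) (v i)) = (\<Prod>i<n. Q (v i, x i)) * exp (- type_sum t \<phi>D)"
    unfolding type_sum_def x[symmetric]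
    using prod_change_of_measure[of n "\<lambda>z. P (snd z) * W (snd z) (fst z)" v x Q \<phi>D]
      PW_tilt[OF Q_pos_of_type[OF x]] by simp
  then show "Pn n x * type_prob t = Tn n v * (\<Prod>i<n. V (v i) (x i)) * exp (- type_sum t \<phi>D)"
    unfolding x[symmetric] Wn_type_prob[symmetric] Pn_def Wn_def Tn_def
    by (simp add: T_mult_V flip: prod.distrib)
qed

lemma type_prob_eq:
  assumes "joint_type n x v = t"
  shows "type_prob t = exp (- type_sum t \<phi>B)"
proof -
  have "(\<Prod>i<n. W (x i) (v i)) = exp (- type_sum t \<phi>B)"
    unfolding type_sum_def assms[symmetric]
    using prod_change_of_measure[of n "\<lambda>z. W (snd z) (fst z)" v x "\<lambda>_. 1" \<phi>B]
      W_tilt[OF Q_pos_of_type[OF assms]] by simp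
  then show ?thesis
    unfolding assms[symmetric] Wn_type_prob[symmetric] Wn_def by simp
qed

lemma class_error_eq:
  "class_error n M L t = exp (- type_sum t \<phi>D) * (\<Sum>v\<in>seqs n. Tn n v * class_V n v t *
     min 1 (class_V n v t * (M * exp (- type_sum t \<phi>A) * min 1 (L * exp (- type_sum t \<phi>B)))))"
  unfolding class_error_def sum_distrib_left
proof (rule sum.cong[OF refl])
  fix v :: "nat \<Rightarrow> 'y"
  show "class_mass n v t * type_prob t * min 1 (M * class_mass n v t * min 1 (L * type_prob t)) =
    exp (- type_sum t \<phi>D) * (Tn n v * class_V n v t *
     min 1 (class_V n v t * (M * exp (- type_sum t \<phi>A) * min 1 (L * exp (- type_sum t \<phi>B)))))"
  proof (cases "\<exists>x. joint_type n x v = t")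
    case True
    then obtain x where x: "joint_type n x v = t" ..
    have "min 1 (M * class_mass n v t * min 1 (L * type_prob t)) =
      min 1 (class_V n v t * (M * exp (- type_sum t \<phi>A) * min 1 (L * exp (- type_sum t \<phi>B))))"
      unfolding type_prob_eq[OF x] class_mass_eq by (simp only: mult_ac)
    then show ?thesis
      unfolding class_mass_type_prob_eq by (simp only: mult_ac)
  next
    case False
    then show ?thesis by (simp add: class_mass_def class_V_def)
  qed
qed

lemma class_error_le:
  assumes "0 \<le> M" "0 \<le> L"
  shows "class_error n M L t \<le> type_exponent t M L"
proof -
  define c where "c = M * exp (- type_sum t \<phi>A) * min 1 (L * exp (- type_sum t \<phi>B))"
  have c: "0 \<le> c" using assms by (simp add: c_def)
  have "(\<Sum>v\<in>seqs n. Tn n v * class_V n v t * min 1 (class_V n v t * c)) \<le> (\<Sum>v\<in>seqs n. Tn n v * min 1 c)"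
  proof (rule sum_mono)
    fix v
    have "class_V n v t * min 1 (class_V n v t * c) \<le> 1 * min 1 c"
      using c class_V_nonneg class_V_le_one
      by (intro mult_mono min.mono mult_left_le_one_le) auto
    then show "Tn n v * class_V n v t * min 1 (class_V n v t * c) \<le> Tn n v * min 1 c"
      using mult_left_mono[OF _ Tn_nonneg[of n v]] by (simp add: mult.assoc)
  qed
  also have "\<dots> = min 1 c" by (simp add: Tn_sum flip: sum_distrib_right)
  finally show ?thesis
    unfolding class_error_eq type_exponent_def c_def[symmetric] by (intro mult_left_mono) auto
qed

text \<open>As \<open>class_V\<close> lies in [0,1], it can be pulled out of the minimum, which
  leaves its second moment under \<open>Tn\<close>. Jensen's inequality, i.e. nonnegativity of the
  variance, bounds this below by the squared mean.\<close>

lemma class_error_ge: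
  assumes "0 \<le> M" "0 \<le> L"
  shows "(\<Sum>v\<in>seqs n. Tn n v * class_V n v t)\<^sup>2 * type_exponent t M L \<le> class_error n M L t"
proof -
  define c where "c = M * exp (- type_sum t \<phi>A) * min 1 (L * exp (- type_sum t \<phi>B))"
  have c: "0 \<le> c" using assms by (simp add: c_def)
  define s where "s = (\<Sum>v\<in>seqs n. Tn n v * class_V n v t)"
  have "0 \<le> (\<Sum>v\<in>seqs n. Tn n v * (class_V n v t - s)\<^sup>2)"
    by (intro sum_nonneg mult_nonneg_nonneg Tn_nonneg) auto
  also have "\<dots> = (\<Sum>v\<in>seqs n. Tn n v * (class_V n v t)\<^sup>2) - 2 * s * s + s\<^sup>2 * (\<Sum>v\<in>seqs n. Tn n v)"
  proof -
    have "(\<Sum>v\<in>seqs n. Tn n v * (class_V n v t - s)\<^sup>2) =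
        (\<Sum>v\<in>seqs n. Tn n v * (class_V n v t)\<^sup>2 - 2 * s * (Tn n v * class_V n v t) + s\<^sup>2 * Tn n v)"
      by (intro sum.cong refl) (simp add: power2_diff algebra_simps)
    then show ?thesis
      by (simp only: sum.distrib sum_subtractf sum_distrib_left[symmetric] s_def[symmetric])
  qed
  finally have jensen: "s\<^sup>2 \<le> (\<Sum>v\<in>seqs n. Tn n v * (class_V n v t)\<^sup>2)"
    by (simp add: Tn_sum power2_eq_square)
  have "s\<^sup>2 * min 1 c \<le> (\<Sum>v\<in>seqs n. Tn n v * (class_V n v t)\<^sup>2) * min 1 c"
    using jensen c by (intro mult_right_mono) auto
  also have "\<dots> \<le> (\<Sum>v\<in>seqs n. Tn n v * class_V n v t * min 1 (class_V n v t * c))"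
    unfolding sum_distrib_right
  proof (rule sum_mono)
    fix v
    have "class_V n v t * min 1 c \<le> min 1 (class_V n v t * c)"
      using c class_V_nonneg[of n v t] class_V_le_one[of n v t]
      by (intro min.boundedI mult_le_one mult_left_mono) auto
    then have "Tn n v * class_V n v t * (class_V n v t * min 1 c) \<le> Tn n v * class_V n v t * min 1 (class_V n v t * c)"
      by (intro mult_left_mono mult_nonneg_nonneg Tn_nonneg class_V_nonneg)
    then show "Tn n v * (class_V n v t)\<^sup>2 * min 1 c \<le> Tn n v * class_V n v t * min 1 (class_V n v t * c)"
      by (simp add: power2_eq_square mult_ac)
  qed
  finally have "exp (- type_sum t \<phi>D) * (s\<^sup>2 * min 1 c) \<le> class_error n M L t"
    unfolding class_error_eq c_def[symmetric] by (intro mult_left_mono) auto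
  then show ?thesis
    unfolding type_exponent_def c_def[symmetric] s_def[symmetric] by (simp add: mult_ac)
qed

end

end

section \<open>The exponent as an upper bound\<close>

lemma min_one_exp: "min 1 (exp s) = exp (- pos_part (- s))"
  by (auto simp: pos_part_def min_def max_def)

lemma pos_part_nonneg: "0 \<le> pos_part s"
  by (simp add: pos_part_def)

lemma pos_part_mult: "0 \<le> c \<Longrightarrow> c * pos_part s = pos_part (c * s)"
  by (simp add: pos_part_def max_mult_distrib_left)

lemma exp_exponent:
  "min 1 (exp (real n * R) * exp (- (real n * a)) * min 1 (exp (real n * K) * exp (- (real n * b)))) =
    exp (- (real n * pos_part (a - R + pos_part (b - K))))"
proof -
  have "min 1 (exp (real n * K) * exp (- (real n * b))) = min 1 (exp (- (real n * (b - K))))"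
    by (simp add: right_diff_distrib flip: exp_add)
  also have "\<dots> = exp (- (real n * pos_part (b - K)))"
    by (simp add: min_one_exp pos_part_mult)
  finally have 1: "min 1 (exp (real n * K) * exp (- (real n * b))) = exp (- (real n * pos_part (b - K)))" .
  have "exp (real n * R) * exp (- (real n * a)) * exp (- (real n * pos_part (b - K))) =
      exp (- (real n * (a - R + pos_part (b - K))))"
    by (simp add: algebra_simps flip: exp_add)
  then show ?thesis
    unfolding 1 by (simp only: min_one_exp) (simp add: pos_part_mult)
qed

lemma num_msgs_le: "real (num_msgs R n) \<le> exp (real n * R)"
  unfolding num_msgs_def by (simp add: of_nat_nat)

lemma num_msgs_ge: "exp (real n * R) - 1 \<le> real (num_msgs R n)"
  unfolding num_msgs_def by (simp add: of_nat_nat)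

lemma num_msgs_pos: "0 \<le> R \<Longrightarrow> 0 < num_msgs R n"
  unfolding num_msgs_def by (simp add: zero_less_nat_eq)

context tilted_channel
begin

definition objective :: "real \<Rightarrow> real \<Rightarrow> real" where
  "objective R K = div_D P W Q + pos_part (A_TV P Q - R + pos_part (B_TV W Q - K))"

text \<open>Gibbs' inequality, from ln u >= 1 - 1/u in each term. It makes the objective bounded
  below, so that \<open>Inf\<close> is a genuine infimum.\<close>

lemma div_D_nonneg: "0 \<le> div_D P W Q"
proof -
  have PW: "(\<Sum>z\<in>UNIV. P (snd z) * W (snd z) (fst z)) = 1"
  proof -
    have "(\<Sum>z\<in>(UNIV :: ('y \<times> 'x) set). P (snd z) * W (snd z) (fst z)) = (\<Sum>y\<in>UNIV. \<Sum>x\<in>UNIV. P x * W x y)"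
      unfolding sum.cartesian_product by (simp add: case_prod_unfold)
    also have "\<dots> = (\<Sum>x\<in>UNIV. P x * (\<Sum>y\<in>UNIV. W x y))"
      by (subst sum.swap) (simp add: sum_distrib_left)
    finally show ?thesis by (simp add: W_sum P_sum)
  qed
  have "Q z - P (snd z) * W (snd z) (fst z) \<le> Q z * \<phi>D z" for z
  proof (cases "0 < Q z")
    case True
    obtain y x where z: "z = (y, x)" by (cases z)
    have pw: "0 < P x * W x y" using True abs_cont z by simp
    have "1 - p / q \<le> ln (q / p)" if "0 < p" "0 < q" for p q :: real
      using ln_le_minus_one[of "p / q"] that by (simp add: ln_div)
    from this[OF pw True] have "Q z * (1 - P x * W x y / Q z) \<le> Q z * ln (Q z / (P x * W x y))"
      using True by (intro mult_left_mono) auto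
    then show ?thesis using True by (simp add: \<phi>D_def z right_diff_distrib)
  next
    case False
    then have "Q z = 0" using Q_nonneg[of z] by simp
    then show ?thesis by (simp add: P_nonneg W_nonneg)
  qed
  then have "(\<Sum>z\<in>UNIV. Q z - P (snd z) * W (snd z) (fst z)) \<le> (\<Sum>z\<in>UNIV. Q z * \<phi>D z)"
    by (intro sum_mono)
  then show ?thesis by (simp add: sum_subtractf Q_sum PW div_D_eq)
qed

lemma objective_nonneg: "0 \<le> objective R K"
  unfolding objective_def by (intro add_nonneg_nonneg div_D_nonneg pos_part_nonneg)

end

context channel
begin

lemma E_e_eq: "E_e P W R K = Inf {tilted_channel.objective P W Q R K | Q. tilted_channel P W Q}"
proof -
  have eq: "joint_dist Q \<and> (\<forall>y x. Q (y, x) > 0 \<longrightarrow> P x * W x y > 0) \<longleftrightarrow> tilted_channel P W Q" for Q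
    using channel_axioms by (auto simp: tilted_channel_def tilted_channel_axioms_def)
  show ?thesis
    unfolding E_e_def eq
    unfolding setcompr_eq_image
    by (intro arg_cong[where f = Inf] image_cong refl) (simp add: tilted_channel.objective_def)
qed

lemma E_e_le: "tilted_channel P W Q \<Longrightarrow> E_e P W R K \<le> tilted_channel.objective P W Q R K"
  unfolding E_e_eq
  by (intro cInf_lower bdd_belowI[where m = 0]) (auto intro: tilted_channel.objective_nonneg)

text \<open>The joint law of \<open>P\<close> and \<open>W\<close> is itself admissible, so the
  infimum is over a nonempty set and can be approached.\<close>

lemma E_e_less:
  assumes "E_e P W R K < r"
  shows "\<exists>Q. tilted_channel P W Q \<and> tilted_channel.objective P W Q R K < r"
proof -
  define Q where "Q z = P (snd z) * W (snd z) (fst z)" for z :: "'y \<times> 'x"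
  have "(\<Sum>z\<in>UNIV. Q z) = (\<Sum>y\<in>UNIV. \<Sum>x\<in>UNIV. P x * W x y)"
    unfolding sum.cartesian_product by (simp add: case_prod_unfold Q_def)
  also have "\<dots> = (\<Sum>x\<in>UNIV. P x * (\<Sum>y\<in>UNIV. W x y))"
    by (subst sum.swap) (simp add: sum_distrib_left)
  also have "\<dots> = 1" by (simp add: W_sum P_sum)
  finally have "joint_dist Q"
    unfolding joint_dist_def by (simp add: Q_def P_nonneg W_nonneg)
  then have "tilted_channel P W Q"
    by (intro tilted_channel.intro channel_axioms tilted_channel_axioms.intro) (simp_all add: Q_def)
  then have "{tilted_channel.objective P W Q R K | Q. tilted_channel P W Q} \<noteq> {}" by auto
  from cInf_lessD[OF this assms[unfolded E_e_eq]] show ?thesis by auto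
qed

text \<open>A type realised with positive probability has an admissible empirical distribution Q =
  t/n. Tilting with this \<open>Q\<close> makes every \<open>type_sum\<close> exactly n times the
  mean, which gives exp(-n objective). All other types contribute 0.\<close>

lemma class_error_le_E_e:
  assumes n: "0 < n"
  shows "class_error n (real (num_msgs R n)) (real (num_msgs K n)) t \<le> exp (- (real n * E_e P W R K))"
proof (cases "\<exists>x v. joint_type n x v = t \<and> 0 < Pn n x \<and> 0 < Wn n x v")
  case False
  have zero: "class_mass n v t * type_prob t = 0" for v
    unfolding class_mass_def sum_distrib_right
  proof (intro sum.neutral ballI)
    fix x assume "x \<in> {x \<in> seqs n. joint_type n x v = t}"
    then have x: "joint_type n x v = t" by simp
    then have "Pn n x = 0 \<or> Wn n x v = 0"
      using False Pn_nonneg[of n x] Wn_nonneg[of n x v] by (metis less_eq_real_def)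
    then show "Pn n x * type_prob t = 0"
      unfolding x[symmetric] Wn_type_prob[symmetric] by auto
  qed
  show ?thesis unfolding class_error_def zero by simp
next
  case True
  then obtain x v where x: "joint_type n x v = t" and pos: "0 < Pn n x" "0 < Wn n x v" by blast
  define Q where "Q z = real (t z) / real n" for z
  have "(\<Sum>z\<in>UNIV. real (t z)) = real n"
    using sum_joint_type[of "\<lambda>_. 1" v x n] by (simp add: x)
  then have jd: "joint_dist Q"
    using n by (simp add: joint_dist_def Q_def flip: sum_divide_distrib)
  interpret tilted_channel P W Q
  proof
    fix y a assume "0 < Q (y, a)"
    then have "0 < t (y, a)" using n by (simp add: Q_def zero_less_divide_iff)
    then obtain i where i: "i < n" "v i = y" "x i = a"
      using joint_type_posD[of n x v "(y, a)"] x by auto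
    have "P (x i) \<noteq> 0" "W (x i) (v i) \<noteq> 0"
      using pos i unfolding Pn_def Wn_def by (metis finite_lessThan lessThan_iff less_irrefl prod_zero)+
    then show "0 < P a * W a y"
      using i P_nonneg[of a] W_nonneg[of a y] by (auto intro!: mult_pos_pos simp: order_less_le)
  qed (rule jd)
  have supp: "0 < Q z" if "0 < t z" for z
    using that n by (simp add: Q_def)
  have ts: "type_sum t \<phi> = real n * (\<Sum>z\<in>UNIV. Q z * \<phi> z)" for \<phi>
    using n by (simp add: type_sum_def Q_def sum_distrib_left)
  let ?a = "A_TV P Q" and ?b = "B_TV W Q" and ?d = "div_D P W Q"
  have "class_error n (real (num_msgs R n)) (real (num_msgs K n)) t
      \<le> type_exponent t (real (num_msgs R n)) (real (num_msgs K n))"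
    by (rule class_error_le[OF supp]) auto
  also have "\<dots> \<le> exp (- (real n * ?d)) *
      min 1 (exp (real n * R) * exp (- (real n * ?a)) * min 1 (exp (real n * K) * exp (- (real n * ?b))))"
    unfolding type_exponent_def ts div_D_eq[symmetric] A_TV_eq[symmetric] B_TV_eq[symmetric]
    by (intro mult_left_mono min.mono mult_mono num_msgs_le order_refl) auto
  also have "\<dots> = exp (- (real n * objective R K))"
    unfolding exp_exponent objective_def by (simp add: algebra_simps flip: exp_add)
  also have "\<dots> \<le> exp (- (real n * E_e P W R K))"
    using E_e_le[OF tilted_channel_axioms] by (simp add: mult_left_mono)
  finally show ?thesis .
qed

text \<open>The number of types enters twice: through the competing pairs in \<open>race_le\<close>
  and through the sum over types.\<close>

lemma avg_error_prob_le:
  assumes "0 < n" "0 \<le> R"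
  shows "avg_error_prob P W R K n \<le>
    2 * (real (n + 1) ^ CARD('y \<times> 'x))\<^sup>2 * exp (- (real n * E_e P W R K))"
proof -
  let ?N = "real (n + 1) ^ CARD('y \<times> 'x)"
  have "(\<Sum>t\<in>types n. class_error n (real (num_msgs R n)) (real (num_msgs K n)) t)
      \<le> (\<Sum>t\<in>(types n :: ('y \<times> 'x \<Rightarrow> nat) set). exp (- (real n * E_e P W R K)))"
    using assms by (intro sum_mono class_error_le_E_e)
  also have "\<dots> = ?N * exp (- (real n * E_e P W R K))"
    by (simp add: card_types)
  finally have le: "(\<Sum>t\<in>types n. class_error n (real (num_msgs R n)) (real (num_msgs K n)) t)
      \<le> ?N * exp (- (real n * E_e P W R K))" .
  have "avg_error_prob P W R K n \<le>
      2 * ?N * (\<Sum>t\<in>types n. class_error n (real (num_msgs R n)) (real (num_msgs K n)) t)"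
    by (rule avg_error_prob_le_class_error[OF num_msgs_pos[OF assms(2)]])
  also have "\<dots> \<le> 2 * ?N * (?N * exp (- (real n * E_e P W R K)))"
    using le by (intro mult_left_mono) auto
  finally show ?thesis by (simp only: power2_eq_square mult.assoc)
qed

end

section \<open>The law of the joint type under independent letter pairs of law
  \<open>Q\<close>\<close>

context tilted_channel
begin

text \<open>By \<open>class_Q_eq\<close> this is the probability of the type class under the product
  law of \<open>Q\<close>, written as the mean that \<open>class_error_ge\<close> squares.\<close>

definition class_Q :: "nat \<Rightarrow> ('y \<times> 'x \<Rightarrow> nat) \<Rightarrow> real" where
  "class_Q n t = (\<Sum>v\<in>seqs n. Tn n v * class_V n v t)"

lemma class_Q_eq:
  "class_Q n t = (\<Sum>v\<in>seqs n. \<Sum>x\<in>{x\<in>seqs n. joint_type n x v = t}. \<Prod>i<n. Q (v i, x i))"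
  unfolding class_Q_def class_V_def Tn_def sum_distrib_left
  by (intro sum.cong refl) (simp add: T_mult_V flip: prod.distrib)

lemma class_Q_nonneg: "0 \<le> class_Q n t"
  unfolding class_Q_def by (intro sum_nonneg mult_nonneg_nonneg Tn_nonneg class_V_nonneg)

lemma sum_class_Q:
  "(\<Sum>t\<in>types n. class_Q n t * F t) =
   (\<Sum>v\<in>seqs n. \<Sum>x\<in>seqs n. (\<Prod>i<n. Q (v i, x i)) * F (joint_type n x v))"
proof -
  have "(\<Sum>t\<in>types n. class_Q n t * F t) =
     (\<Sum>v\<in>seqs n. \<Sum>t\<in>types n. \<Sum>x\<in>{x\<in>seqs n. joint_type n x v = t}. (\<Prod>i<n. Q (v i, x i)) * F (joint_type n x v))"
    unfolding class_Q_eq sum_distrib_right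
    by (rule trans[OF sum.swap]) (intro sum.cong refl, simp only: mem_Collect_eq)
  also have "\<dots> = (\<Sum>v\<in>seqs n. \<Sum>x\<in>seqs n. (\<Prod>i<n. Q (v i, x i)) * F (joint_type n x v))"
    by (intro sum.cong refl sum.group) auto
  finally show ?thesis .
qed

lemma sum_pair_seqs_prod:
  fixes f :: "nat \<Rightarrow> 'y \<times> 'x \<Rightarrow> real"
  shows "(\<Sum>v\<in>seqs n. \<Sum>x\<in>seqs n. \<Prod>i<n. f i (v i, x i)) = (\<Prod>i<n. \<Sum>z\<in>UNIV. f i z)"
proof -
  have "(\<Sum>v\<in>seqs n. \<Sum>x\<in>seqs n. \<Prod>i<n. f i (v i, x i)) =
      (\<Sum>v\<in>seqs n. \<Prod>i<n. \<Sum>a\<in>UNIV. f i (v i, a))"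
    by (intro sum.cong refl) (rule sum_seqs_prod)
  also have "\<dots> = (\<Prod>i<n. \<Sum>y\<in>UNIV. \<Sum>a\<in>UNIV. f i (y, a))"
    by (rule sum_seqs_prod[of "\<lambda>i y. \<Sum>a\<in>UNIV. f i (y, a)"])
  also have "\<dots> = (\<Prod>i<n. \<Sum>z\<in>UNIV. f i z)"
    unfolding sum.cartesian_product by (simp add: case_prod_unfold)
  finally show ?thesis .
qed

lemma sum_class_Q_one: "(\<Sum>t\<in>types n. class_Q n t) = 1"
  using sum_class_Q[of n "\<lambda>_. 1"] sum_pair_seqs_prod[where f = "\<lambda>_. Q" and n = n] by (simp add: Q_sum)

text \<open>Under the product law \<open>type_sum\<close> is a sum of n independent centred
  variables, so the mixed terms of its square vanish.\<close>

lemma type_sum_variance: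
  assumes mean: "(\<Sum>z\<in>UNIV. Q z * \<psi> z) = 0"
  shows "(\<Sum>t\<in>types n. class_Q n t * (type_sum t \<psi>)\<^sup>2) = real n * (\<Sum>z\<in>UNIV. Q z * (\<psi> z)\<^sup>2)"
proof -
  \<comment> \<open>Writing the factors at positions i and j as factors at every position k, equal
    to 1 elsewhere, makes each term a product over positions, also when i = j.\<close>
  let ?g = "\<lambda>i j k z. Q z * ((if k = i then \<psi> z else 1) * (if k = j then \<psi> z else 1))"
  have pull: "(\<Prod>k<n. Q (v k, x k)) * (\<psi> (v i, x i) * \<psi> (v j, x j)) = (\<Prod>k<n. ?g i j k (v k, x k))"
    if "i < n" "j < n" for i j v x
    using that by (simp add: prod.distrib)
  have cov: "(\<Prod>k<n. \<Sum>z\<in>UNIV. ?g i j k z) = (if i = j then \<Sum>z\<in>UNIV. Q z * (\<psi> z)\<^sup>2 else 0)"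
    if ij: "i < n" "j < n" for i j
  proof (cases "i = j")
    case True
    have "(\<Sum>z\<in>UNIV. ?g i j k z) = (if k = i then \<Sum>z\<in>UNIV. Q z * (\<psi> z)\<^sup>2 else 1)" for k
      using True by (simp add: power2_eq_square Q_sum)
    then show ?thesis using True ij by simp
  next
    case False
    then have zero: "(\<Sum>z\<in>UNIV. ?g i j i z) = 0" using mean by simp
    have "(\<Prod>k<n. \<Sum>z\<in>UNIV. ?g i j k z) = 0"
    proof (rule prod_zero[OF finite_lessThan])
      show "\<exists>k\<in>{..<n}. (\<Sum>z\<in>UNIV. ?g i j k z) = 0"
        using zero ij(1) unfolding lessThan_iff[symmetric] by (rule bexI)
    qed
    then show ?thesis using False by simp
  qed
  have "(\<Sum>t\<in>types n. class_Q n t * (type_sum t \<psi>)\<^sup>2) =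
     (\<Sum>v\<in>seqs n. \<Sum>x\<in>seqs n. (\<Prod>k<n. Q (v k, x k)) * (\<Sum>i<n. \<psi> (v i, x i))\<^sup>2)"
    unfolding sum_class_Q type_sum_def sum_joint_type ..
  also have "\<dots> = (\<Sum>v\<in>seqs n. \<Sum>x\<in>seqs n. \<Sum>i<n. \<Sum>j<n. (\<Prod>k<n. ?g i j k (v k, x k)))"
    unfolding power2_eq_square sum_product unfolding sum_distrib_left
    by (intro sum.cong refl) (simp only: pull lessThan_iff)
  also have "\<dots> = (\<Sum>i<n. \<Sum>j<n. \<Sum>v\<in>seqs n. \<Sum>x\<in>seqs n. (\<Prod>k<n. ?g i j k (v k, x k)))"
    by (simp only: sum.swap[of _ "{..<n}" "seqs n"])
  also have "\<dots> = (\<Sum>i<n. \<Sum>j<n. if i = j then \<Sum>z\<in>UNIV. Q z * (\<psi> z)\<^sup>2 else 0)"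
    by (intro sum.cong refl) (use cov in \<open>simp add: sum_pair_seqs_prod[of "\<lambda>k z. ?g _ _ k z"]\<close>)
  finally show ?thesis by simp
qed

end

section \<open>Typical types and the converse bound\<close>

context tilted_channel
begin

lemma class_Q_posD:
  assumes "0 < class_Q n t"
  shows "(\<Sum>z\<in>UNIV. real (t z)) = real n" "0 < t z \<Longrightarrow> 0 < Q z"
proof -
  have "\<exists>v x. joint_type n x v = t \<and> (\<Prod>i<n. Q (v i, x i)) \<noteq> 0"
  proof (rule ccontr)
    assume "\<not> ?thesis"
    then have "(\<Prod>i<n. Q (v i, x i)) = 0" if "joint_type n x v = t" for v x
      using that by blast
    then have "class_Q n t = 0"
      unfolding class_Q_eq by (intro sum.neutral ballI) (simp only: mem_Collect_eq)
    with assms show False by simp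
  qed
  then obtain v x where x: "joint_type n x v = t" and nz: "(\<Prod>i<n. Q (v i, x i)) \<noteq> 0" by blast
  show "(\<Sum>z\<in>UNIV. real (t z)) = real n"
    using sum_joint_type[of "\<lambda>_. 1" v x n] by (simp add: x)
  assume "0 < t z"
  then obtain i where "i < n" "(v i, x i) = z" using joint_type_posD[of n x v z] x by auto
  then have "Q z \<noteq> 0" using nz by auto
  then show "0 < Q z" using Q_nonneg[of z] by simp
qed

text \<open>By Chebyshev's inequality the types with too large a sum for some member of \<Phi> have
  total probability at most 1/2 once n >= 2c/\<epsilon>^2. If all others had probability at most
  1/(4N), where N is the number of types, the total would be at most 3/4.\<close>

lemma typical_type:
  fixes \<Phi> :: "('y \<times> 'x \<Rightarrow> real) set"
  assumes \<epsilon>: "0 < \<epsilon>" and \<Phi>: "finite \<Phi>"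
  shows "\<forall>\<^sub>F n in sequentially. \<exists>t\<in>types n. 1 / (4 * real (n + 1) ^ CARD('y \<times> 'x)) \<le> class_Q n t \<and>
    (\<forall>\<phi>\<in>\<Phi>. type_sum t \<phi> \<le> real n * ((\<Sum>z\<in>UNIV. Q z * \<phi> z) + \<epsilon>))"
proof -
  define \<mu> where "\<mu> \<phi> = (\<Sum>z\<in>UNIV. Q z * \<phi> z)" for \<phi>
  define \<psi> where "\<psi> \<phi> z = \<phi> z - \<mu> \<phi>" for \<phi> z
  define c where "c = (\<Sum>\<phi>\<in>\<Phi>. \<Sum>z\<in>UNIV. Q z * (\<psi> \<phi> z)\<^sup>2)"
  have c: "0 \<le> c" unfolding c_def by (intro sum_nonneg mult_nonneg_nonneg Q_nonneg) auto
  have mean: "(\<Sum>z\<in>UNIV. Q z * \<psi> \<phi> z) = 0" for \<phi>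
    by (simp add: \<psi>_def right_diff_distrib sum_subtractf Q_sum \<mu>_def flip: sum_distrib_right)
  have main: "\<exists>t\<in>types n. 1 / (4 * real (n + 1) ^ CARD('y \<times> 'x)) \<le> class_Q n t \<and>
    (\<forall>\<phi>\<in>\<Phi>. type_sum t \<phi> \<le> real n * (\<mu> \<phi> + \<epsilon>))"
    if n: "0 < n" "2 * c / \<epsilon>\<^sup>2 \<le> real n" for n
  proof (rule ccontr)
    let ?N = "real (n + 1) ^ CARD('y \<times> 'x)"
    assume contr: "\<not> ?thesis"
    \<comment> \<open>Only upward deviations are excluded: they are the ones that would lower the
      error contribution of the type.\<close>
    define B where "B = {t\<in>types n. \<exists>\<phi>\<in>\<Phi>. real n * \<epsilon> < type_sum t (\<psi> \<phi>)}"
    have n\<epsilon>: "0 < real n * \<epsilon>" using n \<epsilon> by simp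
    have "(real n * \<epsilon>)\<^sup>2 * (\<Sum>t\<in>B. class_Q n t) = (\<Sum>t\<in>B. (real n * \<epsilon>)\<^sup>2 * class_Q n t)"
      by (rule sum_distrib_left)
    also have "\<dots> \<le> (\<Sum>t\<in>B. class_Q n t * (\<Sum>\<phi>\<in>\<Phi>. (type_sum t (\<psi> \<phi>))\<^sup>2))"
    proof (rule sum_mono)
      fix t assume "t \<in> B"
      then obtain \<phi> where \<phi>: "\<phi> \<in> \<Phi>" "real n * \<epsilon> < type_sum t (\<psi> \<phi>)" by (auto simp: B_def)
      have "(real n * \<epsilon>)\<^sup>2 \<le> (type_sum t (\<psi> \<phi>))\<^sup>2"
        using \<phi> n\<epsilon> by (intro power_mono) auto
      also have "\<dots> \<le> (\<Sum>\<phi>\<in>\<Phi>. (type_sum t (\<psi> \<phi>))\<^sup>2)"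
        by (rule member_le_sum) (use \<phi> \<Phi> in auto)
      finally have "class_Q n t * (real n * \<epsilon>)\<^sup>2 \<le> class_Q n t * (\<Sum>\<phi>\<in>\<Phi>. (type_sum t (\<psi> \<phi>))\<^sup>2)"
        by (intro mult_left_mono class_Q_nonneg)
      then show "(real n * \<epsilon>)\<^sup>2 * class_Q n t \<le> class_Q n t * (\<Sum>\<phi>\<in>\<Phi>. (type_sum t (\<psi> \<phi>))\<^sup>2)"
        by (simp only: mult.commute)
    qed
    also have "\<dots> \<le> (\<Sum>t\<in>types n. class_Q n t * (\<Sum>\<phi>\<in>\<Phi>. (type_sum t (\<psi> \<phi>))\<^sup>2))"
      by (intro sum_mono2) (auto simp: B_def intro!: mult_nonneg_nonneg class_Q_nonneg sum_nonneg)
    also have "\<dots> = (\<Sum>\<phi>\<in>\<Phi>. \<Sum>t\<in>types n. class_Q n t * (type_sum t (\<psi> \<phi>))\<^sup>2)"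
      unfolding sum_distrib_left by (rule sum.swap)
    also have "\<dots> = real n * c"
      unfolding type_sum_variance[OF mean] c_def by (simp add: sum_distrib_left)
    finally have "(real n * \<epsilon>)\<^sup>2 * (\<Sum>t\<in>B. class_Q n t) \<le> real n * c" .
    moreover have "real n * c \<le> (real n * \<epsilon>)\<^sup>2 * (1 / 2)"
      using n \<epsilon> by (simp add: field_simps power2_eq_square)
    ultimately have "(real n * \<epsilon>)\<^sup>2 * (\<Sum>t\<in>B. class_Q n t) \<le> (real n * \<epsilon>)\<^sup>2 * (1 / 2)" by linarith
    then have bad: "(\<Sum>t\<in>B. class_Q n t) \<le> 1 / 2"
      by (rule mult_left_le_imp_le) (use n \<epsilon> in simp)
    have "class_Q n t \<le> 1 / (4 * ?N)" if t: "t \<in> types n - B" for t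
    proof (rule ccontr)
      assume "\<not> class_Q n t \<le> 1 / (4 * ?N)"
      then have gt: "1 / (4 * ?N) < class_Q n t" by simp
      then have "0 < class_Q n t" by (rule order_le_less_trans[rotated]) simp
      from class_Q_posD(1)[OF this]
      have eq: "type_sum t (\<psi> \<phi>) = type_sum t \<phi> - real n * \<mu> \<phi>" for \<phi>
        by (simp add: type_sum_def \<psi>_def right_diff_distrib sum_subtractf flip: sum_distrib_right)
      have "\<forall>\<phi>\<in>\<Phi>. type_sum t (\<psi> \<phi>) \<le> real n * \<epsilon>"
        using t by (auto simp: B_def not_less)
      then have "\<forall>\<phi>\<in>\<Phi>. type_sum t \<phi> \<le> real n * (\<mu> \<phi> + \<epsilon>)"
        by (simp add: eq algebra_simps)
      then show False using contr gt t by auto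
    qed
    then have "(\<Sum>t\<in>types n - B. class_Q n t) \<le> (\<Sum>t\<in>types n - B. 1 / (4 * ?N))"
      by (intro sum_mono)
    also have "\<dots> \<le> (\<Sum>t\<in>(types n :: ('y \<times> 'x \<Rightarrow> nat) set). 1 / (4 * ?N))"
      by (intro sum_mono2) auto
    also have "\<dots> = 1 / 4" by (simp add: card_types)
    finally have "(\<Sum>t\<in>types n - B. class_Q n t) + (\<Sum>t\<in>B. class_Q n t) \<le> 3 / 4" using bad by simp
    also have "(\<Sum>t\<in>types n - B. class_Q n t) + (\<Sum>t\<in>B. class_Q n t) = (\<Sum>t\<in>types n. class_Q n t)"
      by (intro sum.subset_diff[symmetric]) (auto simp: B_def)
    finally show False by (simp add: sum_class_Q_one)
  qed
  have "0 < n \<and> 2 * c / \<epsilon>\<^sup>2 \<le> real n" if "max 1 (nat \<lceil>2 * c / \<epsilon>\<^sup>2\<rceil>) \<le> n" for n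
    using that by (simp add: nat_le_iff ceiling_le_iff)
  then have "\<forall>\<^sub>F n in sequentially. 0 < n \<and> 2 * c / \<epsilon>\<^sup>2 \<le> real n"
    by (rule eventually_sequentiallyI)
  then show ?thesis
    unfolding \<mu>_def[symmetric] by (rule eventually_mono) (use main in blast)
qed

text \<open>The slack \<epsilon> enters once through D and at most twice through the nested positive
  parts, hence 3\<epsilon>. The two halved cardinalities cost the factor 4.\<close>

lemma type_exponent_ge:
  assumes D: "type_sum t \<phi>D \<le> real n * (div_D P W Q + \<epsilon>)"
    and A: "type_sum t \<phi>A \<le> real n * (A_TV P Q + \<epsilon>)"
    and B: "type_sum t \<phi>B \<le> real n * (B_TV W Q + \<epsilon>)"
    and M: "exp (real n * R) / 2 \<le> M" and L: "exp (real n * K) / 2 \<le> L" and \<epsilon>: "0 \<le> \<epsilon>"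
  shows "exp (- (real n * (objective R K + 3 * \<epsilon>))) / 4 \<le> type_exponent t M L"
proof -
  let ?a = "A_TV P Q" and ?b = "B_TV W Q" and ?d = "div_D P W Q"
  let ?l = "exp (real n * K) * exp (- (real n * (?b + \<epsilon>)))"
  let ?m = "exp (real n * R) * exp (- (real n * (?a + \<epsilon>)))"
  have L': "min 1 ?l / 2 \<le> min 1 (L * exp (- type_sum t \<phi>B))"
  proof -
    have "exp (real n * K) / 2 * exp (- (real n * (?b + \<epsilon>))) \<le> L * exp (- type_sum t \<phi>B)"
      by (rule mult_mono[OF L]) (use B L order_trans[OF _ L, of 0] in auto)
    then show ?thesis by (auto simp: min_def)
  qed
  have M': "?m / 2 \<le> M * exp (- type_sum t \<phi>A)"
    using mult_mono[OF M, of "exp (- (real n * (?a + \<epsilon>)))" "exp (- type_sum t \<phi>A)"] A order_trans[OF _ M, of 0]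
    by simp
  have "(?m / 2) * (min 1 ?l / 2) \<le> M * exp (- type_sum t \<phi>A) * min 1 (L * exp (- type_sum t \<phi>B))"
    by (rule mult_mono[OF M' L']) (use order_trans[OF _ M', of 0] in auto)
  then have "min 1 (?m * min 1 ?l) / 4 \<le> min 1 (M * exp (- type_sum t \<phi>A) * min 1 (L * exp (- type_sum t \<phi>B)))"
    by (auto simp: min_def)
  then have 2: "exp (- (real n * pos_part (?a + \<epsilon> - R + pos_part (?b + \<epsilon> - K)))) / 4 \<le>
      min 1 (M * exp (- type_sum t \<phi>A) * min 1 (L * exp (- type_sum t \<phi>B)))"
    by (simp only: exp_exponent)
  have "real n * pos_part (?a + \<epsilon> - R + pos_part (?b + \<epsilon> - K)) \<le>
      real n * (pos_part (?a - R + pos_part (?b - K)) + 2 * \<epsilon>)"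
    using \<epsilon> by (intro mult_left_mono) (auto simp: pos_part_def)
  then have "exp (- (real n * (pos_part (?a - R + pos_part (?b - K)) + 2 * \<epsilon>))) / 4 \<le>
      exp (- (real n * pos_part (?a + \<epsilon> - R + pos_part (?b + \<epsilon> - K)))) / 4"
    by simp
  from order_trans[OF this 2] have 1: "exp (- (real n * (pos_part (?a - R + pos_part (?b - K)) + 2 * \<epsilon>))) / 4 \<le>
      min 1 (M * exp (- type_sum t \<phi>A) * min 1 (L * exp (- type_sum t \<phi>B)))"
    .
  have "exp (- (real n * (objective R K + 3 * \<epsilon>))) / 4 =
      exp (- (real n * (?d + \<epsilon>))) * (exp (- (real n * (pos_part (?a - R + pos_part (?b - K)) + 2 * \<epsilon>))) / 4)"
    by (simp add: objective_def algebra_simps flip: exp_add)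
  also have "\<dots> \<le> type_exponent t M L"
    unfolding type_exponent_def by (rule mult_mono) (use D 1 in auto)
  finally show ?thesis .
qed

text \<open>The constant 2048 is 16 from the squared pigeonhole bound, times 4 from
  \<open>type_exponent_ge\<close>, times 32 from
  \<open>avg_error_prob_ge_class_error\<close>.\<close>

lemma avg_error_prob_ge:
  assumes \<epsilon>: "0 < \<epsilon>" and R: "0 < R" and K: "0 < K"
  shows "\<forall>\<^sub>F n in sequentially. exp (- (real n * (objective R K + 3 * \<epsilon>))) /
    (2048 * (real (n + 1) ^ CARD('y \<times> 'x))\<^sup>2) \<le> avg_error_prob P W R K n"
proof -
  \<comment> \<open>The threshold 4 gives exp(nR) - 2 >= exp(nR)/2; the 2 pays for the floor and for
    the sent message.\<close>
  have ev: "\<forall>\<^sub>F n in sequentially. 4 \<le> exp (real n * r)" if r: "0 < r" for r :: real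
  proof -
    have "4 \<le> exp (real n * r)" if "nat \<lceil>3 / r\<rceil> \<le> n" for n
    proof -
      have "3 / r \<le> real n" using that by (simp add: nat_le_iff ceiling_le_iff)
      then have "3 \<le> real n * r" using r by (simp add: field_simps)
      then show ?thesis using exp_ge_add_one_self[of "real n * r"] by linarith
    qed
    then show ?thesis by (rule eventually_sequentiallyI)
  qed
  have "\<forall>\<^sub>F n in sequentially. \<exists>t\<in>types n. 1 / (4 * real (n + 1) ^ CARD('y \<times> 'x)) \<le> class_Q n t \<and>
    (\<forall>\<phi>\<in>{\<phi>D, \<phi>A, \<phi>B}. type_sum t \<phi> \<le> real n * ((\<Sum>z\<in>UNIV. Q z * \<phi> z) + \<epsilon>))"
    by (rule typical_type[OF \<epsilon>]) simp
  with ev[OF R] ev[OF K] show ?thesis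
  proof eventually_elim
    case (elim n)
    let ?N = "real (n + 1) ^ CARD('y \<times> 'x)"
    obtain t where t: "t \<in> types n" "1 / (4 * ?N) \<le> class_Q n t"
      "type_sum t \<phi>D \<le> real n * (div_D P W Q + \<epsilon>)" "type_sum t \<phi>A \<le> real n * (A_TV P Q + \<epsilon>)"
      "type_sum t \<phi>B \<le> real n * (B_TV W Q + \<epsilon>)"
      using elim(3) unfolding div_D_eq A_TV_eq B_TV_eq by auto
    have "0 < 1 / (4 * ?N)" by simp
    then have supp: "0 < Q z" if "0 < t z" for z
      using class_Q_posD(2)[OF order_less_le_trans[OF _ t(2)] that] by blast
    have M: "0 < num_msgs R n" and L: "0 < num_msgs K n"
      using R K by (auto intro: num_msgs_pos)
    have "exp (- (real n * (objective R K + 3 * \<epsilon>))) / 4 \<le>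
        type_exponent t (real (num_msgs R n - 1)) (real (num_msgs K n))"
      using t \<epsilon> elim(1,2) num_msgs_ge[of n R] num_msgs_ge[of n K] M
      by (intro type_exponent_ge) (auto simp: of_nat_diff)
    then have "(1 / (4 * ?N))\<^sup>2 * (exp (- (real n * (objective R K + 3 * \<epsilon>))) / 4) \<le>
        (class_Q n t)\<^sup>2 * type_exponent t (real (num_msgs R n - 1)) (real (num_msgs K n))"
      using t(2) by (intro mult_mono power_mono) auto
    also have "\<dots> \<le> class_error n (real (num_msgs R n - 1)) (real (num_msgs K n)) t"
      unfolding class_Q_def by (rule class_error_ge[OF supp]) auto
    finally have "(1 / (4 * ?N))\<^sup>2 * (exp (- (real n * (objective R K + 3 * \<epsilon>))) / 4) / 32 \<le>
        class_error n (real (num_msgs R n - 1)) (real (num_msgs K n)) t / 32"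
      by (rule divide_right_mono) simp
    also have "\<dots> \<le> avg_error_prob P W R K n"
      by (rule avg_error_prob_ge_class_error[OF M L t(1)])
    finally show ?case by (simp add: power2_eq_square mult_ac)
  qed
qed

end

section \<open>Passage to the limit\<close>

lemma ln_poly_over_n:
  fixes c :: real
  assumes "0 < c"
  shows "(\<lambda>n. ln (c * (real (n + 1) ^ d)\<^sup>2) / real n) \<longlonglongrightarrow> 0"
proof -
  have "(\<lambda>n. ln c / real n + 2 * real d * (ln (real (Suc n)) / real (Suc n) * (real (Suc n) / real n)))
      \<longlonglongrightarrow> 0 + 2 * real d * (0 * 1)"
    by (intro tendsto_intros LIMSEQ_Suc[OF lim_ln_over_n] LIMSEQ_Suc_n_over_n
        tendsto_divide_0[OF tendsto_const] filterlim_real_at_infinity_sequentially)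
  moreover have "\<forall>\<^sub>F n in sequentially.
      ln c / real n + 2 * real d * (ln (real (Suc n)) / real (Suc n) * (real (Suc n) / real n)) =
      ln (c * (real (n + 1) ^ d)\<^sup>2) / real n"
    using eventually_gt_at_top[of 0]
  proof eventually_elim
    case (elim n)
    have "ln (c * (real (n + 1) ^ d)\<^sup>2) = ln c + 2 * real d * ln (real (Suc n))"
      using assms by (simp add: ln_mult ln_realpow)
    then show ?case using elim by (simp add: add_divide_distrib del: of_nat_Suc)
  qed
  ultimately show ?thesis by (simp add: tendsto_cong)
qed

theorem theorem1:
  fixes P :: "'x::finite \<Rightarrow> real" and W :: "'x \<Rightarrow> 'y::finite \<Rightarrow> real" and R K :: real
  assumes "\<forall>x. P x \<ge> 0" and "(\<Sum>x\<in>UNIV. P x) = 1"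
    and "\<forall>x y. W x y \<ge> 0" and "\<forall>x. (\<Sum>y\<in>UNIV. W x y) = 1"
    and "R > 0" and "K > 0"
  shows "(\<lambda>n. - (1 / real n) * ln (avg_error_prob P W R K n)) \<longlonglongrightarrow> E_e P W R K"
proof -
  interpret channel P W
    by unfold_locales (use assms in auto)
  let ?p = "avg_error_prob P W R K" and ?E = "E_e P W R K"
  let ?poly = "\<lambda>n. (real (n + 1) ^ CARD('y \<times> 'x))\<^sup>2"
  \<comment> \<open>A lower bound on the error probability. Its positivity is recorded as well,
    since taking logarithms in \<open>upper\<close> relies on it.\<close>
  have lower: "\<forall>\<^sub>F n in sequentially. 0 < ?p n \<and>
      - (1 / real n) * ln (?p n) \<le> r + 3 * \<epsilon> + ln (2048 * ?poly n) / real n"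
    if r: "?E < r" and \<epsilon>: "0 < \<epsilon>" for r \<epsilon>
  proof -
    obtain Q where Q: "tilted_channel P W Q" "tilted_channel.objective P W Q R K < r"
      using E_e_less[OF r] by blast
    show ?thesis
      using tilted_channel.avg_error_prob_ge[OF Q(1) \<epsilon> assms(5,6)] eventually_gt_at_top[of 0]
    proof eventually_elim
      case (elim n)
      let ?o = "tilted_channel.objective P W Q R K"
      have pos: "0 < exp (- (real n * (?o + 3 * \<epsilon>))) / (2048 * ?poly n)" by simp
      have p: "0 < ?p n" using pos elim(1) by (rule order_less_le_trans)
      have "ln (exp (- (real n * (?o + 3 * \<epsilon>))) / (2048 * ?poly n)) \<le> ln (?p n)"
        using pos p elim(1) by (subst ln_le_cancel_iff)
      then have "- ln (?p n) \<le> real n * (?o + 3 * \<epsilon>) + ln (2048 * ?poly n)"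
        by (subst (asm) ln_div) auto
      also have "\<dots> \<le> real n * (r + 3 * \<epsilon>) + ln (2048 * ?poly n)"
        using Q(2) by (intro add_right_mono mult_left_mono) auto
      finally show ?case using p elim(2) by (simp add: field_simps)
    qed
  qed
  have upper: "\<forall>\<^sub>F n in sequentially. ?E - ln (2 * ?poly n) / real n \<le> - (1 / real n) * ln (?p n)"
    using lower[of "?E + 1" 1, simplified] eventually_gt_at_top[of 0]
  proof eventually_elim
    case (elim n)
    have "ln (?p n) \<le> ln (2 * ?poly n * exp (- (real n * ?E)))"
      using avg_error_prob_le[of n R K] elim assms(5) by (subst ln_le_cancel_iff) auto
    also have "\<dots> = ln (2 * ?poly n) - real n * ?E"
      by (subst ln_mult) auto
    finally have "ln (?p n) / real n \<le> (ln (2 * ?poly n) - real n * ?E) / real n"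
      by (rule divide_right_mono) simp
    then show ?case using elim(2) by (simp add: diff_divide_distrib)
  qed
  show ?thesis
  proof (rule order_tendstoI)
    fix a assume a: "a < ?E"
    have "(\<lambda>n. ?E - ln (2 * ?poly n) / real n) \<longlonglongrightarrow> ?E - 0"
      by (intro tendsto_intros ln_poly_over_n) simp
    then have "\<forall>\<^sub>F n in sequentially. a < ?E - ln (2 * ?poly n) / real n"
      using a by (intro order_tendstoD) auto
    with upper show "\<forall>\<^sub>F n in sequentially. a < - (1 / real n) * ln (?p n)"
      by eventually_elim linarith
  next
    fix b assume b: "?E < b"
    \<comment> \<open>Of the five shares of the gap, one goes to approaching the infimum and three
      to the slack 3\<epsilon>; the last absorbs the vanishing logarithmic term.\<close>
    define \<delta> where "\<delta> = (b - ?E) / 5"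
    have \<delta>: "0 < \<delta>" using b by (simp add: \<delta>_def)
    have "(\<lambda>n. ?E + \<delta> + 3 * \<delta> + ln (2048 * ?poly n) / real n) \<longlonglongrightarrow> ?E + \<delta> + 3 * \<delta> + 0"
      by (intro tendsto_intros ln_poly_over_n) simp
    then have "\<forall>\<^sub>F n in sequentially. ?E + \<delta> + 3 * \<delta> + ln (2048 * ?poly n) / real n < b"
      by (rule order_tendstoD(2)) (use b in \<open>simp add: \<delta>_def field_simps\<close>)
    with lower[of "?E + \<delta>" \<delta>, simplified, OF \<delta>] \<delta> show "\<forall>\<^sub>F n in sequentially. - (1 / real n) * ln (?p n) < b"
      by (auto elim: eventually_elim2)
  qed
qed

end
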